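(* Let $1\leqslant p<\infty$ and let $V$ be the Volterra operator on $L_p[0,1]$, $Vf(x)=\int_0^x f(t)\,dt$. If $T\in L(L_p[0,1])$ satisfies $TV=VT$, then $T$ is not weakly supercyclic.
   Context: Scalars are $\mathbb{K}\in\{\mathbb{R},\mathbb{C}\}$. For a Banach space $X$, $L(X)$ is the space of bounded linear operators on $X$. An operator $T\in L(X)$ is weakly supercyclic if there is $x\in X$ such that the projective orbit $O_{\rm pr}(x,T)=\{zT^nx:z\in\mathbb{K},\ n\in\mathbb{Z}_+\}$ is dense in $X$ with respect to the weak topology. *)

theory Defs
  imports "HOL-Analysis.Analysis"
begin

(* L_p[0,1] is modelled by representatives: measurable functions real => 'k
   (with 'k = real or complex) whose p-th power of the norm is integrable on [0,1]
   w.r.t. Lebesgue measure. Elements of the quotient space are identified up to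
   Lp_norm-distance 0 (i.e. a.e. equality). *)

definition Lp01 :: "real \<Rightarrow> (real \<Rightarrow> 'k::{real_normed_field,banach,second_countable_topology}) set" where
  "Lp01 p = {f. f \<in> borel_measurable (lebesgue_on {0..1}) \<and>
                 integrable (lebesgue_on {0..1}) (\<lambda>x. norm (f x) powr p)}"

definition Lp_norm :: "real \<Rightarrow> (real \<Rightarrow> 'k::{real_normed_field,banach,second_countable_topology}) \<Rightarrow> real" where
  "Lp_norm p f = (\<integral>x. norm (f x) powr p \<partial>lebesgue_on {0..1}) powr (1/p)"

definition volterra :: "(real \<Rightarrow> 'k::{real_normed_field,banach,second_countable_topology}) \<Rightarrow> real \<Rightarrow> 'k" where
  "volterra f x = (\<integral>t. indicator {0..x} t *\<^sub>R f t \<partial>lebesgue_on {0..1})"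

definition bounded_op_Lp :: "real \<Rightarrow> ((real \<Rightarrow> 'k::{real_normed_field,banach,second_countable_topology}) \<Rightarrow> (real \<Rightarrow> 'k)) \<Rightarrow> bool" where
  "bounded_op_Lp p T \<longleftrightarrow>
     (\<forall>f\<in>Lp01 p. T f \<in> Lp01 p) \<and>
     (\<forall>f\<in>Lp01 p. \<forall>g\<in>Lp01 p. \<forall>c::'k.
        Lp_norm p (\<lambda>x. T (\<lambda>y. c * f y + g y) x - (c * T f x + T g x)) = 0) \<and>
     (\<exists>C. \<forall>f\<in>Lp01 p. Lp_norm p (T f) \<le> C * Lp_norm p f)"

definition bounded_functional_Lp :: "real \<Rightarrow> ((real \<Rightarrow> 'k::{real_normed_field,banach,second_countable_topology}) \<Rightarrow> 'k) \<Rightarrow> bool" where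
  "bounded_functional_Lp p \<phi> \<longleftrightarrow>
     (\<forall>f\<in>Lp01 p. \<forall>g\<in>Lp01 p. \<forall>c::'k. \<phi> (\<lambda>x. c * f x + g x) = c * \<phi> f + \<phi> g) \<and>
     (\<exists>C. \<forall>f\<in>Lp01 p. norm (\<phi> f) \<le> C * Lp_norm p f)"

(* weak supercyclicity: some projective orbit {z T^n x} is dense in the weak topology,
   i.e. meets every basic weak neighbourhood {y. \<forall>\<phi>\<in>\<Phi>. |\<phi> y - \<phi> g| < e} *)
definition weakly_supercyclic_Lp :: "real \<Rightarrow> ((real \<Rightarrow> 'k::{real_normed_field,banach,second_countable_topology}) \<Rightarrow> (real \<Rightarrow> 'k)) \<Rightarrow> bool" where
  "weakly_supercyclic_Lp p T \<longleftrightarrow>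
     (\<exists>x\<in>Lp01 p. \<forall>g\<in>Lp01 p. \<forall>\<Phi>. finite \<Phi> \<and> (\<forall>\<phi>\<in>\<Phi>. bounded_functional_Lp p \<phi>) \<longrightarrow>
        (\<forall>e>0. \<exists>z::'k. \<exists>n::nat. \<forall>\<phi>\<in>\<Phi>. norm (\<phi> (\<lambda>t. z * (T ^^ n) x t) - \<phi> g) < e))"

end

theory Submission
  imports Defs
begin

text \<open>
  Let \<open>D\<close> be multiplication by the variable, so that \<open>[D, V] = V\<^sup>2\<close>. If \<open>T\<close> commutes with \<open>V\<close>, then by
  the Jacobi identity so does \<open>C = [D, T]\<close>. Polynomials are dense, hence every operator commuting
  with \<open>V\<close> is symmetric for the form \<open>\<beta>(f, g) = V(f * g)(1)\<close>, and any two such operators commute.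
  Therefore \<open>D T\<^sup>n x = T\<^sup>n D x + n T\<^sup>n\<^sup>-\<^sup>1 C x\<close>, and pairing with \<open>T x\<close> yields
  \<open>\<phi>(T\<^sup>n x) = n \<psi>(T\<^sup>n x)\<close> for the two functionals \<open>\<phi>(u) = \<beta>(D u, T x) - \<beta>(u, T D x)\<close> and
  \<open>\<psi>(u) = \<beta>(u, C x)\<close>. On a projective orbit of \<open>x\<close> the quotient of \<open>\<phi>\<close> and \<open>\<psi>\<close> is thus a natural number,
  so a weakly dense orbit forces \<open>\<phi> = \<psi> = 0\<close>. Applying this to \<open>\<beta>\<close> and to \<open>\<beta>(V \<cdot>, \<cdot>)\<close> gives
  \<open>\<beta>(V\<^sup>2 u, T x) = 0\<close> for all \<open>u\<close>; then the nonzero functional \<open>\<beta>(\<cdot>, V\<^sup>2 1)\<close> vanishes on all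
  \<open>T\<^sup>n x\<close> with \<open>n \<ge> 1\<close>, which is again incompatible with weak density.
\<close>

section \<open>The seminormed space\<close>

abbreviation I01 :: "real measure" where "I01 \<equiv> lebesgue_on {0..1}"

lemma finite_measure_I01: "finite_measure I01"
  by (rule finite_measureI) (simp add: space_restrict_space emeasure_restrict_space)

lemma measure_I01: "measure I01 {0..1} = 1"
  by (simp add: measure_restrict_space)

lemma AE_I01I: "(\<And>t. t \<in> {0..1} \<Longrightarrow> P t) \<Longrightarrow> AE t in I01. P t"
  by (rule AE_I2) (simp add: space_restrict_space)

lemma integrable_I01_const [simp]: "integrable I01 (\<lambda>_. c :: 'a::{banach,second_countable_topology})"
  using finite_measure.integrable_const[OF finite_measure_I01] .

text \<open>The norm of a sum is at most twice the larger norm, and the \<open>p\<close>-th power of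
  the larger one is among the two summands. The constant is crude, but it is only used for
  integrability and domination.\<close>

lemma norm_add_powr_le:
  fixes a b :: "'a::real_normed_vector"
  assumes "0 \<le> p"
  shows "norm (a + b) powr p \<le> 2 powr p * (norm a powr p + norm b powr p)"
proof -
  have "norm (a + b) \<le> 2 * max (norm a) (norm b)"
    using norm_triangle_ineq[of a b] by linarith
  then have "norm (a + b) powr p \<le> (2 * max (norm a) (norm b)) powr p"
    using assms by (intro powr_mono2) auto
  also have "\<dots> = 2 powr p * max (norm a) (norm b) powr p"
    by (simp add: powr_mult)
  also have "max (norm a) (norm b) powr p \<le> norm a powr p + norm b powr p"
    by (auto simp: max_def)
  finally show ?thesis by simp
qed

section \<open>Membership in \<open>Lp01\<close> and closure under linear combinations\<close>

lemma Lp01_measurable: "f \<in> Lp01 p \<Longrightarrow> f \<in> borel_measurable I01"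
  and Lp01_integrable: "f \<in> Lp01 p \<Longrightarrow> integrable I01 (\<lambda>x. norm (f x) powr p)"
  by (auto simp: Lp01_def)

lemma Lp01_dominated:
  assumes [measurable]: "f \<in> borel_measurable I01" and "integrable I01 h"
    and le: "\<And>t. t \<in> {0..1} \<Longrightarrow> norm (f t) powr p \<le> h t"
  shows "f \<in> Lp01 p"
  unfolding Lp01_def
proof (intro CollectI conjI)
  show "integrable I01 (\<lambda>x. norm (f x) powr p)"
    using assms(2) 
  proof (rule Bochner_Integration.integrable_bound)
    show "AE x in I01. norm (norm (f x) powr p) \<le> norm (h x)"
      using le by (intro AE_I01I) (force intro: order_trans[OF _ abs_ge_self])
  qed simp
qed fact

lemma Lp01_bounded:
  assumes "f \<in> borel_measurable I01" "0 \<le> p" "\<And>t. t \<in> {0..1} \<Longrightarrow> norm (f t) \<le> C"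
  shows "f \<in> Lp01 p"
  using assms by (intro Lp01_dominated[where h = "\<lambda>_. C powr p"]) (auto intro: powr_mono2)

lemma Lp01_continuous:
  assumes "continuous_on {0..1} f" "0 \<le> p"
  shows "f \<in> Lp01 p"
proof -
  have "bounded (f ` {0..1})"
    using assms compact_continuous_image compact_imp_bounded by blast
  then obtain C where "\<And>t. t \<in> {0..1} \<Longrightarrow> norm (f t) \<le> C"
    unfolding bounded_iff by blast
  with assms show ?thesis
    by (intro Lp01_bounded continuous_imp_measurable_on_sets_lebesgue) auto
qed

lemma Lp01_lincomb:
  assumes "f \<in> Lp01 p" "g \<in> Lp01 p" "0 \<le> p"
  shows "(\<lambda>x. c * f x + g x) \<in> Lp01 p"
proof (rule Lp01_dominated)
  show "integrable I01 (\<lambda>x. 2 powr p * (norm c powr p * norm (f x) powr p + norm (g x) powr p))"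
    using assms by (intro integrable_mult_right Bochner_Integration.integrable_add Lp01_integrable) 
  show "norm (c * f t + g t) powr p \<le> 2 powr p * (norm c powr p * norm (f t) powr p + norm (g t) powr p)" for t
    using norm_add_powr_le[OF assms(3), of "c * f t" "g t"] by (simp add: norm_mult powr_mult)
qed (use assms in \<open>auto dest!: Lp01_measurable\<close>)

lemma Lp01_add: "f \<in> Lp01 p \<Longrightarrow> g \<in> Lp01 p \<Longrightarrow> 0 \<le> p \<Longrightarrow> (\<lambda>x. f x + g x) \<in> Lp01 p"
  using Lp01_lincomb[of f p g 1] by simp

lemma Lp01_diff: "f \<in> Lp01 p \<Longrightarrow> g \<in> Lp01 p \<Longrightarrow> 0 \<le> p \<Longrightarrow> (\<lambda>x. f x - g x) \<in> Lp01 p"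
  using Lp01_lincomb[of g p f "-1"] by simp

lemma Lp01_zero: "(\<lambda>_. 0) \<in> Lp01 p"
  by (simp add: Lp01_def)

lemma Lp01_cmult: "f \<in> Lp01 p \<Longrightarrow> 0 \<le> p \<Longrightarrow> (\<lambda>x. c * f x) \<in> Lp01 p"
  using Lp01_lincomb[of f p "\<lambda>_. 0" c] by (simp add: Lp01_zero)

lemma Lp01_sum:
  assumes "finite A" "\<And>a. a \<in> A \<Longrightarrow> f a \<in> Lp01 p" "0 \<le> p"
  shows "(\<lambda>x. \<Sum>a\<in>A. c a * f a x) \<in> Lp01 p"
  using assms by (induction A rule: finite_induct) (auto intro!: Lp01_lincomb Lp01_zero)

section \<open>The seminorm and its comparison with the L_1 norm\<close>

lemma Lp_norm_nonneg: "0 \<le> Lp_norm p f"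
  by (simp add: Lp_norm_def)

lemma Lp_norm_mono:
  assumes "f \<in> Lp01 p" "g \<in> Lp01 p" "0 < p" "\<And>t. t \<in> {0..1} \<Longrightarrow> norm (f t) \<le> norm (g t)"
  shows "Lp_norm p f \<le> Lp_norm p g"
  unfolding Lp_norm_def using assms
  by (intro powr_mono2 integral_mono_AE AE_I01I Lp01_integrable) (auto intro: powr_mono2)

lemma Lp_norm_le_bound:
  fixes f :: "real \<Rightarrow> 'k::{real_normed_field,banach,second_countable_topology}"
  assumes "f \<in> Lp01 p" "0 < p" "\<And>t. t \<in> {0..1} \<Longrightarrow> norm (f t) \<le> C"
  shows "Lp_norm p f \<le> C"
proof -
  have C: "0 \<le> C" using order_trans[OF norm_ge_zero assms(3)[of 0]] by simp
  have "Lp_norm p f \<le> Lp_norm p (\<lambda>_. of_real C :: 'k)"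
    using C assms by (intro Lp_norm_mono[OF _ Lp01_continuous]) auto
  also have "\<dots> = C"
    using C assms(2) measure_I01 by (simp add: Lp_norm_def powr_powr space_restrict_space)
  finally show ?thesis .
qed

lemma AE_zero_if_Lp_norm_zero:
  assumes "f \<in> Lp01 p" "Lp_norm p f = 0" "0 < p"
  shows "AE t in I01. f t = 0"
proof -
  have "(\<integral>x. norm (f x) powr p \<partial>I01) = 0"
    using assms(2) by (simp add: Lp_norm_def)
  then have "AE t in I01. norm (f t) powr p = 0"
    using integral_nonneg_eq_0_iff_AE[OF Lp01_integrable[OF assms(1)]] by simp
  then show ?thesis by eventually_elim simp
qed

lemma le_one_plus_powr:
  fixes r :: real
  assumes "1 \<le> p" "0 \<le> r"
  shows "r \<le> 1 + r powr p"
proof (cases "r \<le> 1")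
  case False
  then have "r powr 1 \<le> r powr p" using assms by (intro powr_mono) auto
  then show ?thesis using False by simp
qed (simp add: add_increasing2)

lemma Lp01_imp_integrable:
  assumes "f \<in> Lp01 p" "1 \<le> p"
  shows "integrable I01 f"
proof (rule Bochner_Integration.integrable_bound)
  show "integrable I01 (\<lambda>x. 1 + norm (f x) powr p)"
    using assms by (intro Bochner_Integration.integrable_add Lp01_integrable) auto
  show "AE x in I01. norm (f x) \<le> norm (1 + norm (f x) powr p)"
    using le_one_plus_powr[OF assms(2)] by (intro AE_I01I) simp
qed (use assms in \<open>simp add: Lp01_measurable\<close>)

text \<open>A cheap substitute for Hoelder's inequality: integrate \<open>\<bar>r\<bar> \<le> 1 + \<bar>r\<bar>\<^sup>p\<close> after normalising.\<close>
lemma L1_le_Lp_norm: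
  assumes "f \<in> Lp01 p" "1 \<le> p"
  shows "(\<integral>t. norm (f t) \<partial>I01) \<le> 2 * Lp_norm p f"
proof (cases "Lp_norm p f = 0")
  case True
  then have "AE t in I01. norm (f t) = 0"
    using AE_zero_if_Lp_norm_zero[of f p] assms by auto
  then have "(\<integral>t. norm (f t) \<partial>I01) = 0"
    by (rule integral_eq_zero_AE)
  then show ?thesis using True by simp
next
  case False
  let ?N = "Lp_norm p f"
  have N: "?N > 0" using False Lp_norm_nonneg[of p f] by linarith
  have Np: "?N powr p = (\<integral>x. norm (f x) powr p \<partial>I01)"
    using assms by (simp add: Lp_norm_def powr_powr)
  have "(\<integral>t. norm (f t) / ?N \<partial>I01) \<le> (\<integral>t. 1 + norm (f t) powr p / ?N powr p \<partial>I01)"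
  proof (rule integral_mono_AE)
    show "integrable I01 (\<lambda>t. norm (f t) / ?N)"
      using Lp01_imp_integrable[OF assms] by simp
    show int: "integrable I01 (\<lambda>t. 1 + norm (f t) powr p / ?N powr p)"
      using Lp01_integrable[OF assms(1)] by simp
    show "AE t in I01. norm (f t) / ?N \<le> 1 + norm (f t) powr p / ?N powr p"
      using le_one_plus_powr[OF assms(2), of "norm (f _) / ?N"] N
      by (intro AE_I01I) (simp add: powr_divide)
  qed
  also have "\<dots> = 1 + (\<integral>t. norm (f t) powr p \<partial>I01) / ?N powr p"
    using Lp01_integrable[OF assms(1)] measure_I01
    by (subst Bochner_Integration.integral_add) (auto simp: space_restrict_space)
  also have "\<dots> = 2" using N unfolding Np[symmetric] by simp
  finally show ?thesis using N by (simp add: field_simps)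
qed

section \<open>Bounded functionals and density of polynomials\<close>

lemma bounded_functional_lincomb:
  assumes "bounded_functional_Lp p \<phi>" "f \<in> Lp01 p" "g \<in> Lp01 p"
  shows "\<phi> (\<lambda>x. c * f x + g x) = c * \<phi> f + \<phi> g"
  using assms by (simp add: bounded_functional_Lp_def)

lemma bounded_functional_bound:
  assumes "bounded_functional_Lp p \<phi>"
  obtains C where "0 \<le> C" "\<And>f. f \<in> Lp01 p \<Longrightarrow> norm (\<phi> f) \<le> C * Lp_norm p f"
proof -
  obtain C where C: "\<And>f. f \<in> Lp01 p \<Longrightarrow> norm (\<phi> f) \<le> C * Lp_norm p f"
    using assms unfolding bounded_functional_Lp_def by blast
  show thesis
  proof
    fix f :: "real \<Rightarrow> 'a" assume "f \<in> Lp01 p"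
    then show "norm (\<phi> f) \<le> max C 0 * Lp_norm p f"
      by (rule order_trans[OF C]) (simp add: mult_right_mono Lp_norm_nonneg)
  qed simp
qed

lemma bounded_functional_zero: "bounded_functional_Lp p \<phi> \<Longrightarrow> \<phi> (\<lambda>_. 0) = 0"
  using bounded_functional_lincomb[of p \<phi> "\<lambda>_. 0" "\<lambda>_. 0" 1] by (simp add: Lp01_zero)

lemma bounded_functional_add:
  "bounded_functional_Lp p \<phi> \<Longrightarrow> f \<in> Lp01 p \<Longrightarrow> g \<in> Lp01 p \<Longrightarrow> \<phi> (\<lambda>x. f x + g x) = \<phi> f + \<phi> g"
  using bounded_functional_lincomb[of p \<phi> f g 1] by simp

lemma bounded_functional_diff:
  "bounded_functional_Lp p \<phi> \<Longrightarrow> f \<in> Lp01 p \<Longrightarrow> g \<in> Lp01 p \<Longrightarrow> \<phi> (\<lambda>x. f x - g x) = \<phi> f - \<phi> g"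
  using bounded_functional_lincomb[of p \<phi> g f "-1"] by simp

lemma bounded_functional_cmult:
  "bounded_functional_Lp p \<phi> \<Longrightarrow> f \<in> Lp01 p \<Longrightarrow> \<phi> (\<lambda>x. c * f x) = c * \<phi> f"
  using bounded_functional_lincomb[of p \<phi> f "\<lambda>_. 0" c] by (simp add: Lp01_zero bounded_functional_zero)

lemma bounded_functional_sum:
  assumes \<phi>: "bounded_functional_Lp p \<phi>" and "finite A" "\<And>a. a \<in> A \<Longrightarrow> f a \<in> Lp01 p" "0 \<le> p"
  shows "\<phi> (\<lambda>x. \<Sum>a\<in>A. c a * f a x) = (\<Sum>a\<in>A. c a * \<phi> (f a))"
  using assms(2,3)
proof (induction A rule: finite_induct)
  case (insert a A)
  then show ?case
    using assms(4) by (simp add: bounded_functional_lincomb[OF \<phi>] Lp01_sum)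
qed (simp add: bounded_functional_zero[OF \<phi>])

lemma bounded_functional_Lp_lincomb:
  assumes "bounded_functional_Lp p \<phi>" "bounded_functional_Lp p \<psi>"
  shows "bounded_functional_Lp p (\<lambda>f. c * \<phi> f + \<psi> f)"
proof -
  obtain A where A: "0 \<le> A" "\<And>f. f \<in> Lp01 p \<Longrightarrow> norm (\<phi> f) \<le> A * Lp_norm p f"
    using bounded_functional_bound[OF assms(1)] by blast
  obtain B where B: "0 \<le> B" "\<And>f. f \<in> Lp01 p \<Longrightarrow> norm (\<psi> f) \<le> B * Lp_norm p f"
    using bounded_functional_bound[OF assms(2)] by blast
  have "norm (c * \<phi> f + \<psi> f) \<le> (norm c * A + B) * Lp_norm p f" if "f \<in> Lp01 p" for f
  proof -
    have "norm (c * \<phi> f + \<psi> f) \<le> norm c * norm (\<phi> f) + norm (\<psi> f)"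
      by (metis norm_mult norm_triangle_ineq)
    also have "\<dots> \<le> norm c * (A * Lp_norm p f) + B * Lp_norm p f"
      using A(2)[OF that] B(2)[OF that] by (intro add_mono mult_left_mono) auto
    finally show ?thesis by (simp add: algebra_simps)
  qed
  then have "\<exists>C. \<forall>f\<in>Lp01 p. norm (c * \<phi> f + \<psi> f) \<le> C * Lp_norm p f" by blast
  then show ?thesis
    using assms by (simp add: bounded_functional_Lp_def algebra_simps)
qed

lemma bounded_functional_Lp_add:
  "bounded_functional_Lp p \<phi> \<Longrightarrow> bounded_functional_Lp p \<psi> \<Longrightarrow> bounded_functional_Lp p (\<lambda>f. \<phi> f + \<psi> f)"
  using bounded_functional_Lp_lincomb[of p \<phi> \<psi> 1] by simp

lemma bounded_functional_Lp_diff: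
  "bounded_functional_Lp p \<phi> \<Longrightarrow> bounded_functional_Lp p \<psi> \<Longrightarrow> bounded_functional_Lp p (\<lambda>f. \<phi> f - \<psi> f)"
  using bounded_functional_Lp_lincomb[of p \<psi> \<phi> "-1"] by simp

text \<open>Boundedness makes a functional blind to differences of seminorm zero, so it lives on the
  quotient space although it is defined on representatives.\<close>

lemma bounded_functional_cong:
  assumes "bounded_functional_Lp p \<phi>" "f \<in> Lp01 p" "g \<in> Lp01 p" "0 \<le> p"
    and "Lp_norm p (\<lambda>t. f t - g t) = 0"
  shows "\<phi> f = \<phi> g"
proof -
  obtain C where C: "\<And>f. f \<in> Lp01 p \<Longrightarrow> norm (\<phi> f) \<le> C * Lp_norm p f"
    using bounded_functional_bound[OF assms(1)] by blast
  have "norm (\<phi> (\<lambda>t. f t - g t)) \<le> 0"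
    using C[OF Lp01_diff[OF assms(2-4)]] assms(5) by simp
  then show ?thesis using bounded_functional_diff[OF assms(1-3)] by simp
qed

lemma bounded_functional_cong_on:
  assumes "bounded_functional_Lp p \<phi>" "f \<in> Lp01 p" "g \<in> Lp01 p" "0 \<le> p"
    and "\<And>t. t \<in> {0..1} \<Longrightarrow> f t = g t"
  shows "\<phi> f = \<phi> g"
proof (rule bounded_functional_cong[OF assms(1-4)])
  have "(\<integral>t. norm (f t - g t) powr p \<partial>I01) = 0"
    using assms(5) by (intro integral_eq_zero_AE AE_I01I) simp
  then show "Lp_norm p (\<lambda>t. f t - g t) = 0" by (simp add: Lp_norm_def)
qed

section \<open>From monomials to continuous functions, indicators, simple functions and all of
  \<open>Lp01\<close>\<close>

lemma bounded_functional_limit_zero: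
  assumes \<phi>: "bounded_functional_Lp p \<phi>" and p: "0 < p"
    and f: "f \<in> Lp01 p" and s: "\<And>i. s i \<in> Lp01 p" "\<And>i. \<phi> (s i) = 0"
    and h: "integrable I01 h" "\<And>i t. t \<in> {0..1} \<Longrightarrow> norm (f t - s i t) powr p \<le> h t"
    and lim: "AE t in I01. (\<lambda>i. s i t) \<longlonglongrightarrow> f t"
  shows "\<phi> f = 0"
proof -
  obtain C where C: "0 \<le> C" "\<And>f. f \<in> Lp01 p \<Longrightarrow> norm (\<phi> f) \<le> C * Lp_norm p f"
    using bounded_functional_bound[OF \<phi>] by blast
  have d: "(\<lambda>t. f t - s i t) \<in> Lp01 p" for i
    using f s(1) p by (intro Lp01_diff) auto
  \<comment> \<open>Dominated convergence turns pointwise convergence into convergence in seminorm,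
    along which \<open>\<phi>\<close> is continuous.\<close>
  have "(\<lambda>i. \<integral>t. norm (f t - s i t) powr p \<partial>I01) \<longlonglongrightarrow> (\<integral>t. 0 \<partial>I01)"
  proof (rule integral_dominated_convergence[OF _ _ h(1)])
    show "AE t in I01. (\<lambda>i. norm (f t - s i t) powr p) \<longlonglongrightarrow> 0"
      using lim
    proof eventually_elim
      case (elim t)
      have "(\<lambda>i. norm (f t - s i t)) \<longlonglongrightarrow> 0"
        using tendsto_norm[OF tendsto_diff[OF tendsto_const elim, of "f t"]] by simp
      then show ?case
        by (rule tendsto_zero_powrI[where g = "\<lambda>_. p"]) (use p in auto)
    qed
    show "AE t in I01. norm (norm (f t - s i t) powr p) \<le> h t" for i
      using h(2) by (intro AE_I01I) simp
  qed (use Lp01_measurable[OF d] in auto)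
  then have "(\<lambda>i. Lp_norm p (\<lambda>t. f t - s i t)) \<longlonglongrightarrow> 0"
    unfolding Lp_norm_def by (intro tendsto_zero_powrI[where g = "\<lambda>_. 1/p" and b = "1/p"]) (use p in auto)
  then have "(\<lambda>i. C * Lp_norm p (\<lambda>t. f t - s i t)) \<longlonglongrightarrow> 0"
    by (rule tendsto_mult_right_zero)
  moreover have "norm (\<phi> f) \<le> C * Lp_norm p (\<lambda>t. f t - s i t)" for i
    using C(2)[OF d, of i] bounded_functional_diff[OF \<phi> f s(1), of i] s(2)[of i] by simp
  ultimately have "norm (\<phi> f) \<le> 0"
    by (intro LIMSEQ_le_const) auto
  then show ?thesis by simp
qed

text \<open>The factorial normalises the monomials so that \<open>volterra\<close> sends each one to
  the next.\<close>

definition monom01 :: "nat \<Rightarrow> real \<Rightarrow> 'k::{real_normed_field,banach,second_countable_topology}" where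
  "monom01 i t = of_real (t ^ i / fact i)"

lemma monom01_Lp01: "0 \<le> p \<Longrightarrow> monom01 i \<in> Lp01 p"
  unfolding monom01_def by (intro Lp01_continuous continuous_intros) auto

text \<open>By Stone-Weierstrass a continuous function is a uniform limit of polynomials, which are
  combinations of the \<open>monom01 i\<close>.\<close>

lemma bounded_functional_continuous_eq_zero:
  fixes \<phi> :: "(real \<Rightarrow> 'k::{real_normed_field,banach,second_countable_topology}) \<Rightarrow> 'k"
  assumes \<phi>: "bounded_functional_Lp p \<phi>" and p: "0 < p"
    and van: "\<And>i. \<phi> (monom01 i) = 0" and g: "continuous_on {0..1} g"
  shows "\<phi> (\<lambda>t. of_real (g t)) = 0"
proof -
  have "\<exists>P. real_polynomial_function P \<and> (\<forall>t\<in>{0..1}. \<bar>g t - P t\<bar> < inverse (Suc n))" for n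
    using Stone_Weierstrass_real_polynomial_function[OF compact_Icc g, of "inverse (Suc n)"]
    by (metis inverse_positive_iff_positive of_nat_0_less_iff zero_less_Suc)
  then obtain P where P: "\<And>n. real_polynomial_function (P n)"
      "\<And>n t. t \<in> {0..1} \<Longrightarrow> \<bar>g t - P n t\<bar> < inverse (Suc n)"
    by metis
  have poly: "\<phi> (\<lambda>t. of_real (P n t)) = 0" for n
  proof -
    obtain a k where "P n = (\<lambda>x. \<Sum>i\<le>k. a i * x ^ i)"
      using P(1) real_polynomial_function_iff_sum by blast
    then have "(\<lambda>t. of_real (P n t) :: 'k) = (\<lambda>t. \<Sum>i\<le>k. of_real (a i * fact i) * monom01 i t)"
      by (simp add: monom01_def)
    then show ?thesis
      using p by (simp add: bounded_functional_sum[OF \<phi>] monom01_Lp01 van)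
  qed
  show ?thesis
  proof (rule bounded_functional_limit_zero[OF \<phi> p _ _ poly, where h = "\<lambda>_. 1"])
    have "continuous_on {0..1} (P n)" for n
      using P(1) by (simp add: continuous_on_polymonial_function real_polynomial_function_eq)
    then show "(\<lambda>t. of_real (P n t)) \<in> Lp01 p" for n
      using p by (intro Lp01_continuous continuous_on_of_real) auto
    show "(\<lambda>t. of_real (g t)) \<in> Lp01 p"
      using p g by (intro Lp01_continuous continuous_on_of_real) auto
    show "norm (of_real (g t) - of_real (P n t) :: 'k) powr p \<le> 1" if "t \<in> {0..1}" for n t
    proof -
      have "\<bar>g t - P n t\<bar> \<le> 1"
        using P(2)[OF that, of n] inverse_le_1_iff[of "real (Suc n)"] by linarith
      then show ?thesis
        using p by (simp flip: of_real_diff add: powr_le1)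
    qed
    show "AE t in I01. (\<lambda>n. of_real (P n t) :: 'k) \<longlonglongrightarrow> of_real (g t)"
    proof (intro AE_I01I tendsto_of_real)
      fix t :: real assume t: "t \<in> {0..1}"
      have "(\<lambda>n. P n t - g t) \<longlonglongrightarrow> 0"
        using P(2)[OF t]
        by (intro Lim_null_comparison[OF _ LIMSEQ_inverse_real_of_nat] always_eventually)
          (auto simp: abs_minus_commute intro: less_imp_le)
      then show "(\<lambda>n. P n t) \<longlonglongrightarrow> g t" by (simp add: LIM_zero_iff)
    qed
  qed simp
qed

text \<open>A measurable function is a limit of continuous ones off a negligible set, which reduces
  the claim to the continuous case.\<close>

lemma bounded_functional_indicator_eq_zero:
  fixes \<phi> :: "(real \<Rightarrow> 'k::{real_normed_field,banach,second_countable_topology}) \<Rightarrow> 'k"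
  assumes \<phi>: "bounded_functional_Lp p \<phi>" and p: "0 < p"
    and van: "\<And>i. \<phi> (monom01 i) = 0" and S: "S \<in> sets I01"
  shows "\<phi> (\<lambda>t. of_real (indicator S t)) = 0"
proof -
  have "indicator S \<in> borel_measurable I01" using S by simp
  then have "(indicator S :: real \<Rightarrow> real) measurable_on {0..1}"
    by (simp add: measurable_on_iff_borel_measurable)
  then obtain N g where N: "negligible N" and cont: "\<And>n::nat. continuous_on UNIV (g n)"
    and g: "\<And>x. x \<notin> N \<Longrightarrow> (\<lambda>n. g n x) \<longlonglongrightarrow> (if x \<in> {0..1} then indicator S x else 0 :: real)"
    unfolding measurable_on_def by blast
  \<comment> \<open>Clamping to [0,1] keeps continuity, provides a constant majorant and leaves the
    limit alone, since an indicator takes values in [0,1].\<close>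
  define h where "h n t = max 0 (min 1 (g n t))" for n t
  have hc: "continuous_on {0..1} (h n)" for n
    unfolding h_def by (intro continuous_intros continuous_on_subset[OF cont]) auto
  have h01: "0 \<le> h n t" "h n t \<le> 1" for n t
    by (auto simp: h_def)
  show ?thesis
  proof (rule bounded_functional_limit_zero[OF \<phi> p, where h = "\<lambda>_. 1"])
    show "\<phi> (\<lambda>t. of_real (h n t)) = 0" for n
      by (rule bounded_functional_continuous_eq_zero[OF \<phi> p van hc])
    show "(\<lambda>t. of_real (h n t)) \<in> Lp01 p" for n
      using p hc by (intro Lp01_continuous continuous_on_of_real) auto
    show "(\<lambda>t. of_real (indicator S t)) \<in> Lp01 p"
      using p S by (intro Lp01_bounded[where C = 1]) (auto simp: indicator_def)
    show "norm (of_real (indicator S t) - of_real (h n t) :: 'k) powr p \<le> 1" for n t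
      using h01[of n t] p by (simp flip: of_real_diff add: powr_le1 indicator_def)
    have "AE t in lebesgue. t \<notin> N"
      using N by (simp add: AE_iff_null_sets[symmetric] negligible_iff_null_sets AE_not_in)
    then have "AE t in I01. t \<notin> N"
      by (simp add: AE_restrict_space_iff) (auto elim: eventually_mono)
    moreover have "AE t in I01. t \<in> {0..1}" by (rule AE_I01I)
    ultimately show "AE t in I01. (\<lambda>n. of_real (h n t) :: 'k) \<longlonglongrightarrow> of_real (indicator S t)"
    proof eventually_elim
      case (elim t)
      have "(\<lambda>n. h n t) \<longlonglongrightarrow> max 0 (min 1 (indicator S t))"
        unfolding h_def using g[of t] elim by (intro tendsto_intros) auto
      also have "max 0 (min 1 (indicator S t)) = (indicator S t :: real)"
        by (simp add: indicator_def)
      finally show ?case by (rule tendsto_of_real)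
    qed
  qed simp
qed

theorem bounded_functional_eq_zero:
  fixes \<phi> :: "(real \<Rightarrow> 'k::{real_normed_field,banach,second_countable_topology}) \<Rightarrow> 'k"
  assumes \<phi>: "bounded_functional_Lp p \<phi>" and p: "0 < p"
    and van: "\<And>i. \<phi> (monom01 i) = 0" and f: "f \<in> Lp01 p"
  shows "\<phi> f = 0"
proof -
  obtain s where s: "\<And>i. simple_function I01 (s i)"
      "\<And>x. x \<in> {0..1} \<Longrightarrow> (\<lambda>i. s i x) \<longlonglongrightarrow> f x"
      "\<And>i x. x \<in> {0..1} \<Longrightarrow> norm (s i x) \<le> 2 * norm (f x)"
    using borel_measurable_implies_sequence_metric[OF Lp01_measurable[OF f], of 0]
    unfolding dist_0_norm dist_norm diff_0_right space_lebesgue_on by blast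
  \<comment> \<open>An integrable majorant for all the errors \<open>f - s i\<close> at once, from
    \<open>norm (s i t) \<le> 2 * norm (f t)\<close>.\<close>
  define h where "h t = 2 powr p * (norm (f t) powr p + (2 * norm (f t)) powr p)" for t
  have h: "integrable I01 h"
    unfolding h_def using Lp01_integrable[OF f] p by (simp add: powr_mult)
  have le_h: "norm (f t - s i t) powr p \<le> h t" if "t \<in> {0..1}" for i t
  proof -
    have "norm (f t - s i t) powr p \<le> 2 powr p * (norm (f t) powr p + norm (s i t) powr p)"
      using norm_add_powr_le[of p "f t" "- s i t"] p by simp
    also have "\<dots> \<le> h t"
      unfolding h_def using s(3)[OF that] p by (intro mult_left_mono add_mono powr_mono2) auto
    finally show ?thesis .
  qed
  have sL: "s i \<in> Lp01 p" for i
  proof (rule Lp01_dominated[OF borel_measurable_simple_function[OF s(1)]])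
    show "integrable I01 (\<lambda>t. (2 * norm (f t)) powr p)"
      using Lp01_integrable[OF f] by (simp add: powr_mult)
    show "norm (s i t) powr p \<le> (2 * norm (f t)) powr p" if "t \<in> {0..1}" for t
      using s(3)[OF that] p by (intro powr_mono2) auto
  qed
  have "\<phi> (s i) = 0" for i
  proof -
    define A where "A = s i ` {0..1}"
    have A: "finite A"
      using simple_functionD(1)[OF s(1)[of i]] by (simp add: A_def space_restrict_space)
    \<comment> \<open>The level sets of the simple function \<open>s i\<close>, which is the sum of
      its values times their indicators.\<close>
    define B where "B y = s i -` {y} \<inter> {0..1}" for y
    have B: "B y \<in> sets I01" for y
      using simple_functionD(2)[OF s(1)[of i], of "{y}"] by (simp add: B_def space_restrict_space)
    have BL: "(\<lambda>t. of_real (indicator (B y) t) :: 'k) \<in> Lp01 p" for y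
      using p B by (intro Lp01_bounded[where C = 1]) (auto simp: indicator_def)
    have "\<phi> (s i) = \<phi> (\<lambda>t. \<Sum>y\<in>A. y * of_real (indicator (B y) t))"
    proof (rule bounded_functional_cong_on[OF \<phi> sL])
      fix t :: real assume t: "t \<in> {0..1}"
      have "(\<Sum>y\<in>A. y * of_real (indicator (B y) t)) = (\<Sum>y\<in>A. if y = s i t then y else 0)"
        using t by (intro sum.cong) (auto simp: B_def indicator_def)
      also have "\<dots> = s i t" using A t by (simp add: A_def)
      finally show "s i t = (\<Sum>y\<in>A. y * of_real (indicator (B y) t))" ..
    qed (use p A BL in \<open>auto intro!: Lp01_sum\<close>)
    also have "\<dots> = (\<Sum>y\<in>A. y * \<phi> (\<lambda>t. of_real (indicator (B y) t)))"
      using p A BL by (intro bounded_functional_sum[OF \<phi>]) auto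
    also have "\<dots> = 0"
      using bounded_functional_indicator_eq_zero[OF \<phi> p van B] by simp
    finally show ?thesis .
  qed
  then show ?thesis
    using s(2) by (intro bounded_functional_limit_zero[OF \<phi> p f sL _ h le_h] AE_I01I)
qed

text \<open>This is how identities between forms are proved below: fix one argument and reduce the
  other to monomials, then exchange the roles.\<close>

corollary bounded_functional_eqI:
  assumes "bounded_functional_Lp p \<phi>" "bounded_functional_Lp p \<psi>" "0 < p"
    and "\<And>i. \<phi> (monom01 i) = \<psi> (monom01 i)" "f \<in> Lp01 p"
  shows "\<phi> f = \<psi> f"
  using bounded_functional_eq_zero[OF bounded_functional_Lp_diff[OF assms(1,2)] assms(3) _ assms(5)] assms(4)
  by simp

section \<open>The Volterra operator and weak equality\<close>

text \<open>Functions are representatives of classes modulo null sets, and \<open>T\<close> is linear only up to such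
  sets; testing with bounded functionals avoids passing to the quotient.\<close>

definition weak_op :: "real \<Rightarrow> ((real \<Rightarrow> 'k::{real_normed_field,banach,second_countable_topology}) \<Rightarrow> real \<Rightarrow> 'k) \<Rightarrow> bool" where
  "weak_op p T \<longleftrightarrow> (\<forall>f\<in>Lp01 p. T f \<in> Lp01 p) \<and>
     (\<forall>\<phi>. bounded_functional_Lp p \<phi> \<longrightarrow> bounded_functional_Lp p (\<lambda>f. \<phi> (T f)))"

definition weak_eq :: "real \<Rightarrow> (real \<Rightarrow> 'k::{real_normed_field,banach,second_countable_topology}) \<Rightarrow> (real \<Rightarrow> 'k) \<Rightarrow> bool" where
  "weak_eq p f g \<longleftrightarrow> (\<forall>\<phi>. bounded_functional_Lp p \<phi> \<longrightarrow> \<phi> f = \<phi> g)"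

section \<open>Calculus of weak equality and of operators tested by functionals\<close>

lemma weak_eqI: "(\<And>\<phi>. bounded_functional_Lp p \<phi> \<Longrightarrow> \<phi> f = \<phi> g) \<Longrightarrow> weak_eq p f g"
  and weak_eqD: "weak_eq p f g \<Longrightarrow> bounded_functional_Lp p \<phi> \<Longrightarrow> \<phi> f = \<phi> g"
  unfolding weak_eq_def by blast+

lemma weak_eq_refl: "weak_eq p f f"
  by (simp add: weak_eqI)

lemma weak_eq_trans: "weak_eq p f g \<Longrightarrow> weak_eq p g h \<Longrightarrow> weak_eq p f h"
  by (rule weak_eqI) (rule trans[OF weak_eqD weak_eqD])

lemma weak_eq_on:
  assumes "f \<in> Lp01 p" "g \<in> Lp01 p" "0 \<le> p" "\<And>t. t \<in> {0..1} \<Longrightarrow> f t = g t"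
  shows "weak_eq p f g"
  by (rule weak_eqI) (rule bounded_functional_cong_on[OF _ assms])

text \<open>Linearity up to weak equality is enough, because every test functional turns it into an
  exact identity.\<close>

lemma weak_opI:
  assumes "0 \<le> p" and mem: "\<And>f. f \<in> Lp01 p \<Longrightarrow> T f \<in> Lp01 p"
    and lin: "\<And>f g c. f \<in> Lp01 p \<Longrightarrow> g \<in> Lp01 p \<Longrightarrow>
        weak_eq p (T (\<lambda>x. c * f x + g x)) (\<lambda>x. c * T f x + T g x)"
    and bound: "\<And>f. f \<in> Lp01 p \<Longrightarrow> Lp_norm p (T f) \<le> C * Lp_norm p f"
  shows "weak_op p T"
  unfolding weak_op_def
proof (intro conjI allI impI ballI mem)
  fix \<phi> :: "(real \<Rightarrow> 'a) \<Rightarrow> 'a" assume \<phi>: "bounded_functional_Lp p \<phi>"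
  obtain A where A: "0 \<le> A" "\<And>f. f \<in> Lp01 p \<Longrightarrow> norm (\<phi> f) \<le> A * Lp_norm p f"
    using bounded_functional_bound[OF \<phi>] by blast
  have "norm (\<phi> (T f)) \<le> A * C * Lp_norm p f" if f: "f \<in> Lp01 p" for f
    using order_trans[OF A(2)[OF mem[OF f]] mult_left_mono[OF bound[OF f] A(1)]]
    by (simp add: mult.assoc)
  moreover have "\<phi> (T (\<lambda>x. c * f x + g x)) = c * \<phi> (T f) + \<phi> (T g)"
    if "f \<in> Lp01 p" "g \<in> Lp01 p" for f g c
    using weak_eqD[OF lin[OF that] \<phi>] bounded_functional_lincomb[OF \<phi> mem mem, OF that] by simp
  ultimately show "bounded_functional_Lp p (\<lambda>f. \<phi> (T f))"
    unfolding bounded_functional_Lp_def by blast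
qed

lemma weak_op_Lp01: "weak_op p T \<Longrightarrow> f \<in> Lp01 p \<Longrightarrow> T f \<in> Lp01 p"
  and weak_op_functional: "weak_op p T \<Longrightarrow> bounded_functional_Lp p \<phi> \<Longrightarrow> bounded_functional_Lp p (\<lambda>f. \<phi> (T f))"
  unfolding weak_op_def by blast+

lemma weak_eq_op:
  assumes "weak_op p T" "weak_eq p f g"
  shows "weak_eq p (T f) (T g)"
  using weak_eqD[OF assms(2) weak_op_functional[OF assms(1)]] by (rule weak_eqI)

lemma weak_op_comp: "weak_op p T \<Longrightarrow> weak_op p U \<Longrightarrow> weak_op p (\<lambda>f. T (U f))"
  unfolding weak_op_def[of p "\<lambda>f. T (U f)"]
proof (intro conjI ballI allI impI)
  assume TU: "weak_op p T" "weak_op p U"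
  show "T (U f) \<in> Lp01 p" if "f \<in> Lp01 p" for f
    by (rule weak_op_Lp01[OF TU(1) weak_op_Lp01[OF TU(2) that]])
  fix \<phi> :: "(real \<Rightarrow> 'a) \<Rightarrow> 'a" assume "bounded_functional_Lp p \<phi>"
  then show "bounded_functional_Lp p (\<lambda>f. \<phi> (T (U f)))"
    by (rule weak_op_functional[OF TU(2) weak_op_functional[OF TU(1)]])
qed

lemma weak_op_funpow: "weak_op p T \<Longrightarrow> weak_op p (T ^^ n)"
proof (induction n)
  case (Suc n)
  then show ?case
    using weak_op_comp[of p T "T ^^ n"] by (simp add: comp_def)
qed (simp add: weak_op_def)

lemma weak_op_diff:
  assumes "weak_op p T" "weak_op p U" "0 \<le> p"
  shows "weak_op p (\<lambda>f x. T f x - U f x)"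
  unfolding weak_op_def
proof (intro conjI ballI allI impI)
  show "(\<lambda>x. T f x - U f x) \<in> Lp01 p" if "f \<in> Lp01 p" for f
    by (rule Lp01_diff[OF weak_op_Lp01[OF assms(1) that] weak_op_Lp01[OF assms(2) that] assms(3)])
  fix \<phi> :: "(real \<Rightarrow> 'a) \<Rightarrow> 'a" assume \<phi>: "bounded_functional_Lp p \<phi>"
  have "bounded_functional_Lp p (\<lambda>f. \<phi> (T f) - \<phi> (U f))"
    by (rule bounded_functional_Lp_diff[OF weak_op_functional[OF assms(1) \<phi>] weak_op_functional[OF assms(2) \<phi>]])
  moreover have "\<phi> (\<lambda>x. T f x - U f x) = \<phi> (T f) - \<phi> (U f)" if "f \<in> Lp01 p" for f
    by (rule bounded_functional_diff[OF \<phi> weak_op_Lp01[OF assms(1) that] weak_op_Lp01[OF assms(2) that]])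
  \<comment> \<open>The two functionals are known to agree only on \<open>Lp01\<close>, so
    boundedness is carried over through its definition instead of by equality of functions.\<close>
  ultimately show "bounded_functional_Lp p (\<lambda>f. \<phi> (\<lambda>x. T f x - U f x))"
    using assms(3) unfolding bounded_functional_Lp_def by (simp add: Lp01_lincomb)
qed

lemma bounded_op_imp_weak_op:
  assumes "bounded_op_Lp p T" "0 \<le> p"
  shows "weak_op p T"
proof -
  have mem: "\<And>f. f \<in> Lp01 p \<Longrightarrow> T f \<in> Lp01 p"
    and lin: "\<And>f g c. f \<in> Lp01 p \<Longrightarrow> g \<in> Lp01 p \<Longrightarrow>
       Lp_norm p (\<lambda>x. T (\<lambda>y. c * f y + g y) x - (c * T f x + T g x)) = 0"
    using assms(1) by (auto simp: bounded_op_Lp_def)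
  obtain C where C: "\<And>f. f \<in> Lp01 p \<Longrightarrow> Lp_norm p (T f) \<le> C * Lp_norm p f"
    using assms(1) unfolding bounded_op_Lp_def by blast
  show ?thesis
  proof (rule weak_opI[OF assms(2) mem _ C])
    fix f g :: "real \<Rightarrow> 'a" and c :: 'a assume fg: "f \<in> Lp01 p" "g \<in> Lp01 p"
    show "weak_eq p (T (\<lambda>x. c * f x + g x)) (\<lambda>x. c * T f x + T g x)"
    proof (rule weak_eqI)
      fix \<phi> :: "(real \<Rightarrow> 'a) \<Rightarrow> 'a" assume "bounded_functional_Lp p \<phi>"
      from bounded_functional_cong[OF this _ _ assms(2) lin[OF fg]]
      show "\<phi> (T (\<lambda>x. c * f x + g x)) = \<phi> (\<lambda>x. c * T f x + T g x)"
        using fg assms(2) by (simp add: mem Lp01_lincomb)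
    qed
  qed
qed

lemma of_real_measurable_I01: "(\<lambda>t. of_real t :: 'k::{real_normed_field,banach,second_countable_topology}) \<in> borel_measurable I01"
  by (intro continuous_imp_measurable_on_sets_lebesgue continuous_intros) auto

lemma weak_op_mult_id:
  fixes p :: real
  assumes p: "1 \<le> p"
  shows "weak_op p (\<lambda>f t. of_real t * f t)"
proof -
  have le: "norm (of_real t * f t) \<le> norm (f t)" if "t \<in> {0..1}" for t and f :: "real \<Rightarrow> 'a"
    using that by (simp add: norm_mult mult_left_le_one_le)
  have mem: "(\<lambda>t. of_real t * f t) \<in> Lp01 p" if f: "f \<in> Lp01 p" for f :: "real \<Rightarrow> 'a"
    using Lp01_measurable[OF f] of_real_measurable_I01 Lp01_integrable[OF f] le p
    by (intro Lp01_dominated[where h = "\<lambda>t. norm (f t) powr p"] borel_measurable_times powr_mono2) auto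
  show ?thesis
  proof (rule weak_opI[where C = 1])
    show "Lp_norm p (\<lambda>t. of_real t * f t) \<le> 1 * Lp_norm p f" if "f \<in> Lp01 p" for f :: "real \<Rightarrow> 'a"
      using p le[where f = f] Lp_norm_mono[OF mem[OF that] that] by simp
  qed (use p mem in \<open>auto simp: algebra_simps weak_eq_refl\<close>)
qed

section \<open>The Volterra operator as a bounded operator\<close>

lemma borel_measurable_I01: "f \<in> borel_measurable borel \<Longrightarrow> f \<in> borel_measurable I01"
  by (simp add: measurable_restrict_space1 measurable_completion)

lemma volterra_integrable:
  assumes "f \<in> Lp01 p" "1 \<le> p"
  shows "integrable I01 (\<lambda>t. indicator {0..x} t *\<^sub>R f t)"
  using Lp01_imp_integrable[OF assms]
proof (rule Bochner_Integration.integrable_bound)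
  have "(indicator {0..x} :: real \<Rightarrow> real) \<in> borel_measurable I01"
    by (intro borel_measurable_I01) simp
  then show "(\<lambda>t. indicator {0..x} t *\<^sub>R f t) \<in> borel_measurable I01"
    using Lp01_measurable[OF assms(1)] by simp
qed (auto intro!: AE_I01I simp: indicator_def)

lemma volterra_lincomb:
  assumes "f \<in> Lp01 p" "g \<in> Lp01 p" "1 \<le> p"
  shows "volterra (\<lambda>x. c * f x + g x) = (\<lambda>x. c * volterra f x + volterra g x)"
proof
  fix x
  have "volterra (\<lambda>x. c * f x + g x) x = (\<integral>t. c * (indicator {0..x} t *\<^sub>R f t) + indicator {0..x} t *\<^sub>R g t \<partial>I01)"
    unfolding volterra_def by (simp add: algebra_simps)
  also have "\<dots> = c * volterra f x + volterra g x"
    unfolding volterra_def using volterra_integrable[OF assms(1,3)] volterra_integrable[OF assms(2,3)]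
    by (subst Bochner_Integration.integral_add)
      (auto simp del: mult_scaleR_right intro!: integral_mult_right)
  finally show "volterra (\<lambda>x. c * f x + g x) x = c * volterra f x + volterra g x" .
qed

text \<open>Each value of \<open>volterra f\<close> is bounded by the L_1 norm of \<open>f\<close>;
  the factor 2 comes from \<open>L1_le_Lp_norm\<close>.\<close>

lemma norm_volterra_le:
  assumes "f \<in> Lp01 p" "1 \<le> p"
  shows "norm (volterra f x) \<le> 2 * Lp_norm p f"
proof -
  have "norm (volterra f x) \<le> (\<integral>t. norm (indicator {0..x} t *\<^sub>R f t) \<partial>I01)"
    unfolding volterra_def by (rule integral_norm_bound)
  also have "\<dots> \<le> (\<integral>t. norm (f t) \<partial>I01)"
    using integrable_norm[OF volterra_integrable[OF assms]] integrable_norm[OF Lp01_imp_integrable[OF assms]]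
    by (rule integral_mono) (simp add: indicator_def)
  also have "\<dots> \<le> 2 * Lp_norm p f"
    by (rule L1_le_Lp_norm[OF assms])
  finally show ?thesis .
qed

text \<open>The value at \<open>x\<close> is an integral with a jointly measurable kernel, hence
  measurable in the parameter \<open>x\<close>. Borel measurability on the whole line survives the
  substitution of \<open>1 - t\<close> in the convolution form.\<close>

lemma volterra_measurable:
  assumes [measurable]: "f \<in> borel_measurable I01"
  shows "volterra f \<in> borel_measurable borel"
proof -
  interpret finite_measure I01 by (rule finite_measure_I01)
  have [measurable]: "(\<lambda>t. t) \<in> I01 \<rightarrow>\<^sub>M borel"
    by (intro continuous_imp_measurable_on_sets_lebesgue continuous_intros) auto
  have "(\<lambda>x. \<integral>t. (if 0 \<le> t \<and> t \<le> x then 1 else 0) *\<^sub>R f t \<partial>I01) \<in> borel_measurable borel"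
    by (rule borel_measurable_lebesgue_integral) measurable
  moreover have "volterra f = (\<lambda>x. \<integral>t. (if 0 \<le> t \<and> t \<le> x then 1 else 0) *\<^sub>R f t \<partial>I01)"
    by (auto simp: volterra_def fun_eq_iff indicator_def of_bool_def)
  ultimately show ?thesis by simp
qed

lemma volterra_Lp01:
  assumes "f \<in> Lp01 p" "1 \<le> p"
  shows "volterra f \<in> Lp01 p"
  using assms by (intro Lp01_bounded[OF borel_measurable_I01[OF volterra_measurable] _ norm_volterra_le] Lp01_measurable) auto

lemma weak_op_volterra:
  assumes p: "1 \<le> p"
  shows "weak_op p volterra"
proof (rule weak_opI[where C = 2])
  show "Lp_norm p (volterra f) \<le> 2 * Lp_norm p f" if "f \<in> Lp01 p" for f :: "real \<Rightarrow> 'a"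
    using p that by (intro Lp_norm_le_bound volterra_Lp01 norm_volterra_le) auto
qed (use p in \<open>auto simp: volterra_Lp01 volterra_lincomb weak_eq_refl\<close>)

text \<open>The bridge from gauge integrals, where the fundamental theorem of calculus is applied,
  to Lebesgue integrals with values in the scalar field.\<close>

lemma integral_I01_of_real:
  assumes "integrable I01 g" "(g has_integral J) {0..1}"
  shows "(\<integral>t. of_real (g t) \<partial>I01) = (of_real J :: 'k::{real_normed_field,banach,second_countable_topology})"
proof -
  have "(\<integral>t. of_real (g t) \<partial>I01) = (of_real (\<integral>t. g t \<partial>I01) :: 'k)"
    using integral_bounded_linear[OF bounded_linear_of_real assms(1)] .
  then show ?thesis
    using lebesgue_integral_eq_integral[OF assms(1)] assms(2) by (simp add: integral_unique)
qed

section \<open>The Volterra operator on monomials\<close>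

lemma DERIV_power_over_fact:
  "((\<lambda>t::real. t ^ Suc i / fact (Suc i)) has_real_derivative t ^ i / fact i) (at t within S)"
proof -
  have "real (Suc i) * t ^ i / fact (Suc i) = t ^ i / fact i"
    by (simp add: divide_simps del: of_nat_Suc)
  then show ?thesis
    using DERIV_cdivide[OF DERIV_pow[of "Suc i" t S], where c = "fact (Suc i)"]
    by (simp del: of_nat_Suc power_Suc fact_Suc)
qed

lemma volterra_monom01:
  assumes "x \<in> {0..1}"
  shows "volterra (monom01 i) x = monom01 (Suc i) x"
proof -
  let ?g = "\<lambda>t. if t \<in> {0..x} then t ^ i / fact i else 0 :: real"
  have "((\<lambda>t. t ^ i / fact i) has_integral x ^ Suc i / fact (Suc i) - 0 ^ Suc i / fact (Suc i)) {0..x}"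
    using assms
    by (intro fundamental_theorem_of_calculus)
      (auto intro!: DERIV_power_over_fact simp flip: has_real_derivative_iff_has_vector_derivative
        simp del: power_Suc fact_Suc)
  then have "(?g has_integral x ^ Suc i / fact (Suc i)) {0..1}"
    using assms by (subst has_integral_restrict) auto
  moreover have "integrable I01 ?g"
  proof -
    have "monom01 i \<in> Lp01 1" by (rule monom01_Lp01) simp
    from volterra_integrable[OF this, of x] show ?thesis
      by (rule Bochner_Integration.integrable_cong[THEN iffD1, rotated 2]) (auto simp: monom01_def indicator_def)
  qed
  ultimately have "(\<integral>t. of_real (?g t) \<partial>I01) = (of_real (x ^ Suc i / fact (Suc i)) :: 'a)"
    by (rule integral_I01_of_real[rotated])
  moreover have "volterra (monom01 i) x = ((\<integral>t. of_real (?g t) \<partial>I01) :: 'a)"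
    unfolding volterra_def monom01_def by (intro Bochner_Integration.integral_cong) (auto simp: indicator_def)
  ultimately show ?thesis by (simp add: monom01_def)
qed

lemma weak_eq_volterra_monom01:
  assumes "1 \<le> p"
  shows "weak_eq p (volterra (monom01 i)) (monom01 (Suc i))"
  using assms by (intro weak_eq_on volterra_monom01 volterra_Lp01 monom01_Lp01) auto

section \<open>The convolution form\<close>

text \<open>An abstract class of forms, because the argument needs both the convolution form and its
  shift by \<open>volterra\<close>. Boundedness is asked in the first argument; symmetry passes it
  to the second.\<close>

definition volterra_form :: "real \<Rightarrow> ((real \<Rightarrow> 'k::{real_normed_field,banach,second_countable_topology}) \<Rightarrow> (real \<Rightarrow> 'k) \<Rightarrow> 'k) \<Rightarrow> bool" where
  "volterra_form p \<beta> \<longleftrightarrow>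
     (\<forall>g\<in>Lp01 p. bounded_functional_Lp p (\<lambda>f. \<beta> f g)) \<and>
     (\<forall>f\<in>Lp01 p. \<forall>g\<in>Lp01 p. \<beta> f g = \<beta> g f \<and> \<beta> (volterra f) g = \<beta> f (volterra g))"

lemma volterra_form_functional: "volterra_form p \<beta> \<Longrightarrow> g \<in> Lp01 p \<Longrightarrow> bounded_functional_Lp p (\<lambda>f. \<beta> f g)"
  and volterra_form_sym: "volterra_form p \<beta> \<Longrightarrow> f \<in> Lp01 p \<Longrightarrow> g \<in> Lp01 p \<Longrightarrow> \<beta> f g = \<beta> g f"
  and volterra_form_volterra: "volterra_form p \<beta> \<Longrightarrow> f \<in> Lp01 p \<Longrightarrow> g \<in> Lp01 p \<Longrightarrow> \<beta> (volterra f) g = \<beta> f (volterra g)"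
  by (simp_all add: volterra_form_def)

text \<open>The shifted form stays symmetric because \<open>\<beta> (volterra f) g = \<beta> f
  (volterra g) = \<beta> (volterra g) f\<close>.\<close>

lemma volterra_form_shift:
  assumes "volterra_form p \<beta>" "1 \<le> p"
  shows "volterra_form p (\<lambda>f. \<beta> (volterra f))"
  unfolding volterra_form_def
proof (intro conjI ballI)
  fix g :: "real \<Rightarrow> 'a" assume g: "g \<in> Lp01 p"
  show "bounded_functional_Lp p (\<lambda>f. \<beta> (volterra f) g)"
    using weak_op_functional[OF weak_op_volterra[OF assms(2)] volterra_form_functional[OF assms(1) g]] .
next
  fix f g :: "real \<Rightarrow> 'a" assume f: "f \<in> Lp01 p" and g: "g \<in> Lp01 p"
  have V: "volterra f \<in> Lp01 p" "volterra g \<in> Lp01 p"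
    using f g assms(2) by (auto intro: volterra_Lp01)
  show "\<beta> (volterra f) g = \<beta> (volterra g) f"
    using volterra_form_volterra[OF assms(1) f g] volterra_form_sym[OF assms(1) f V(2)] by simp
  show "\<beta> (volterra (volterra f)) g = \<beta> (volterra f) (volterra g)"
    using volterra_form_volterra[OF assms(1) V(1) g] .
qed

lemma volterra_form_cong:
  assumes "volterra_form p \<beta>" "weak_eq p f f'" "g \<in> Lp01 p"
  shows "\<beta> f g = \<beta> f' g"
  by (rule weak_eqD[OF assms(2) volterra_form_functional[OF assms(1,3)]])

text \<open>\<open>conv_form f g\<close> is the integral over \<open>[0,1]\<close> of the convolution of \<open>f\<close> and \<open>g\<close>.\<close>

definition conv_form :: "(real \<Rightarrow> 'k::{real_normed_field,banach,second_countable_topology}) \<Rightarrow> (real \<Rightarrow> 'k) \<Rightarrow> 'k" where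
  "conv_form f g = (\<integral>t. f t * volterra g (1 - t) \<partial>I01)"

text \<open>\<open>volterra g\<close> is bounded by twice the seminorm of \<open>g\<close>, and the
  L_1 norm of \<open>f\<close> by twice that of \<open>f\<close>; hence the factor 4.\<close>

lemma conv_form_integrable_bound:
  assumes f: "f \<in> Lp01 p" and g: "g \<in> Lp01 p" and p: "1 \<le> p"
  shows "integrable I01 (\<lambda>t. f t * volterra g (1 - t))" (is ?int)
    and "norm (conv_form f g) \<le> 4 * Lp_norm p f * Lp_norm p g" (is ?bound)
proof -
  have le: "norm (f t * volterra g (1 - t)) \<le> norm (f t) * (2 * Lp_norm p g)" for t
    using norm_volterra_le[OF g p] by (simp add: norm_mult mult_left_mono)
  have [measurable]: "volterra g \<in> borel_measurable borel"
    by (rule volterra_measurable[OF Lp01_measurable[OF g]])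
  have int: "integrable I01 (\<lambda>t. norm (f t) * (2 * Lp_norm p g))"
    using Lp01_imp_integrable[OF f p] by simp
  show i: ?int
    using int
  proof (rule Bochner_Integration.integrable_bound)
    show "(\<lambda>t. f t * volterra g (1 - t)) \<in> borel_measurable I01"
      by (intro borel_measurable_times Lp01_measurable[OF f] borel_measurable_I01) measurable
  qed (use le Lp_norm_nonneg[of p g] in \<open>auto intro!: AE_I01I\<close>)
  have "norm (conv_form f g) \<le> (\<integral>t. norm (f t * volterra g (1 - t)) \<partial>I01)"
    unfolding conv_form_def by (rule integral_norm_bound)
  also have "\<dots> \<le> (\<integral>t. norm (f t) * (2 * Lp_norm p g) \<partial>I01)"
    using integrable_norm[OF i] int le by (rule integral_mono)
  also have "\<dots> = (\<integral>t. norm (f t) \<partial>I01) * (2 * Lp_norm p g)" by simp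
  also have "\<dots> \<le> 2 * Lp_norm p f * (2 * Lp_norm p g)"
    using L1_le_Lp_norm[OF f p] Lp_norm_nonneg[of p g] by (intro mult_right_mono) auto
  finally show ?bound by (simp add: mult_ac)
qed

lemma conv_form_functional:
  fixes f g :: "real \<Rightarrow> 'a::{real_normed_field,banach,second_countable_topology}"
  assumes p: "1 \<le> p"
  shows "g \<in> Lp01 p \<Longrightarrow> bounded_functional_Lp p (\<lambda>f. conv_form f g)"
    and "f \<in> Lp01 p \<Longrightarrow> bounded_functional_Lp p (conv_form f)"
proof -
  have l: "conv_form (\<lambda>x. c * f x + f' x) g = c * conv_form f g + conv_form f' g"
    if "f \<in> Lp01 p" "f' \<in> Lp01 p" "g \<in> Lp01 p" for f f' g :: "real \<Rightarrow> 'a" and c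
    using conv_form_integrable_bound(1)[OF that(1,3) p] conv_form_integrable_bound(1)[OF that(2,3) p]
    by (simp add: conv_form_def distrib_right mult.assoc)
  have r: "conv_form g (\<lambda>x. c * f x + f' x) = c * conv_form g f + conv_form g f'"
    if "f \<in> Lp01 p" "f' \<in> Lp01 p" "g \<in> Lp01 p" for f f' g :: "real \<Rightarrow> 'a" and c
    using conv_form_integrable_bound(1)[OF that(3,1) p] conv_form_integrable_bound(1)[OF that(3,2) p]
    by (simp add: conv_form_def volterra_lincomb[OF that(1,2) p] distrib_left mult.left_commute)
  show "bounded_functional_Lp p (\<lambda>f. conv_form f g)" if g: "g \<in> Lp01 p"
    unfolding bounded_functional_Lp_def
  proof (intro conjI ballI allI l g exI)
    show "norm (conv_form f g) \<le> 4 * Lp_norm p g * Lp_norm p f" if "f \<in> Lp01 p" for f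
      using conv_form_integrable_bound(2)[OF that g p] by (simp add: mult_ac)
  qed
  show "bounded_functional_Lp p (conv_form f)" if f: "f \<in> Lp01 p"
    unfolding bounded_functional_Lp_def
  proof (intro conjI ballI allI exI)
    show "norm (conv_form f g) \<le> 4 * Lp_norm p f * Lp_norm p g" if "g \<in> Lp01 p" for g
      by (rule conv_form_integrable_bound(2)[OF f that p])
  qed (rule r[OF _ _ f])
qed

text \<open>Euler's Beta value B(i+1, j+1) divided by i! j!.\<close>

definition beta01 :: "nat \<Rightarrow> nat \<Rightarrow> real" where
  "beta01 i j = integral {0..1} (\<lambda>t. t ^ i / fact i * ((1 - t) ^ j / fact j))"

lemma beta01_has_integral:
  "((\<lambda>t. t ^ i / fact i * ((1 - t) ^ j / fact j)) has_integral beta01 i j) {0..1}"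
  unfolding beta01_def
  by (intro integrable_integral integrable_continuous_real continuous_intros) auto

lemma DERIV_flipped_power_over_fact:
  "((\<lambda>t::real. (1 - t) ^ Suc j / fact (Suc j)) has_real_derivative - ((1 - t) ^ j / fact j)) (at t within S)"
proof -
  have "((\<lambda>t. 1 - t) has_real_derivative -1) (at t within S)"
    by (auto intro!: derivative_eq_intros)
  from DERIV_chain2[where f = "\<lambda>t. t ^ Suc j / fact (Suc j)" and g = "\<lambda>t. 1 - t", OF DERIV_power_over_fact this]
  show ?thesis by simp
qed

text \<open>Integration by parts: the product of the two normalised powers with exponents
  \<open>Suc i\<close> and \<open>Suc j\<close> vanishes at both endpoints.\<close>

lemma beta01_Suc: "beta01 (Suc i) j = beta01 i (Suc j)"
proof -
  have "((\<lambda>t. t ^ i / fact i * ((1 - t) ^ Suc j / fact (Suc j)) - t ^ Suc i / fact (Suc i) * ((1 - t) ^ j / fact j))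
      has_integral (1 ^ Suc i / fact (Suc i) * ((1 - 1) ^ Suc j / fact (Suc j)) - 0 ^ Suc i / fact (Suc i) * ((1 - 0) ^ Suc j / fact (Suc j)))) {0..1::real}"
    using DERIV_mult[OF DERIV_power_over_fact DERIV_flipped_power_over_fact]
    by (intro fundamental_theorem_of_calculus)
      (auto simp flip: has_real_derivative_iff_has_vector_derivative simp del: power_Suc fact_Suc simp: algebra_simps)
  then show ?thesis
    using has_integral_unique[OF _ has_integral_diff[OF beta01_has_integral[of i "Suc j"] beta01_has_integral[of "Suc i" j]]]
    by fastforce
qed

text \<open>Repeated shifting shows that only \<open>i + j\<close> matters, which is the source of
  the symmetry of the convolution form.\<close>

lemma beta01_eq: "beta01 i j = beta01 0 (i + j)"
  by (induction i arbitrary: j) (auto simp: beta01_Suc)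

lemma beta01_value: "beta01 i j = 1 / fact (Suc (i + j))"
proof -
have "((\<lambda>t. (1 - t) ^ k / fact k) has_integral - ((1 - 1) ^ Suc k / fact (Suc k)) - - ((1 - 0) ^ Suc k / fact (Suc k))) {0..1::real}" for k
    using DERIV_minus[OF DERIV_flipped_power_over_fact]
    by (intro fundamental_theorem_of_calculus)
      (auto simp flip: has_real_derivative_iff_has_vector_derivative simp del: power_Suc fact_Suc)
  then have "beta01 0 k = 1 / fact (Suc k)" for k
    unfolding beta01_def by (intro integral_unique) auto
  then show ?thesis by (simp only: beta01_eq[of i j])
qed

text \<open>The second index is \<open>Suc j\<close> because \<open>conv_form\<close> applies
  \<open>volterra\<close> to its second argument.\<close>

lemma conv_form_monom01: "conv_form (monom01 i) (monom01 j) = of_real (beta01 i (Suc j))"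
proof -
  have "conv_form (monom01 i) (monom01 j) =
      ((\<integral>t. of_real (t ^ i / fact i * ((1 - t) ^ Suc j / fact (Suc j))) \<partial>I01) :: 'a)"
    unfolding conv_form_def
    by (intro Bochner_Integration.integral_cong) (auto simp: volterra_monom01 monom01_def)
  also have "\<dots> = of_real (beta01 i (Suc j))"
    by (intro integral_I01_of_real beta01_has_integral continuous_imp_integrable_real continuous_intros) auto
  finally show ?thesis .
qed

text \<open>Both sides of each identity are bounded functionals of either argument, so monomials
  suffice; there the value depends only on the sum of the indices.\<close>

lemma volterra_form_conv_form:
  assumes p: "1 \<le> p"
  shows "volterra_form p conv_form"
proof -
  have p0: "0 < p" "0 \<le> p" using p by auto
  note L = conv_form_functional(1)[OF p] and R = conv_form_functional(2)[OF p]
  note e = monom01_Lp01[OF p0(2)]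
  have sym: "conv_form f g = conv_form g f" if f: "f \<in> Lp01 p" and g: "g \<in> Lp01 p" for f g :: "real \<Rightarrow> 'a"
  proof (rule bounded_functional_eqI[OF L[OF g] R[OF g] p0(1) _ f])
    fix i show "conv_form (monom01 i) g = conv_form g (monom01 i)"
      by (rule bounded_functional_eqI[OF R[OF e] L[OF e] p0(1) _ g])
        (simp add: conv_form_monom01 beta01_eq[of i] beta01_eq[of _ "Suc i"] add.commute)
  qed
  have V: "conv_form (volterra f) g = conv_form f (volterra g)"
    if f: "f \<in> Lp01 p" and g: "g \<in> Lp01 p" for f g :: "real \<Rightarrow> 'a"
  proof (rule bounded_functional_eqI[OF weak_op_functional[OF weak_op_volterra[OF p] L[OF g]] L[OF volterra_Lp01[OF g p]] p0(1) _ f])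
    fix i
    show "conv_form (volterra (monom01 i)) g = conv_form (monom01 i) (volterra g)"
    proof (rule bounded_functional_eqI[OF R[OF volterra_Lp01[OF e p]] weak_op_functional[OF weak_op_volterra[OF p] R[OF e]] p0(1) _ g])
      fix j
      have "conv_form (volterra (monom01 i)) (monom01 j) = conv_form (monom01 (Suc i)) (monom01 j :: real \<Rightarrow> 'a)"
        by (rule weak_eqD[OF weak_eq_volterra_monom01[OF p] L[OF e]])
      moreover have "conv_form (monom01 i) (volterra (monom01 j)) = conv_form (monom01 i) (monom01 (Suc j) :: real \<Rightarrow> 'a)"
        by (rule weak_eqD[OF weak_eq_volterra_monom01[OF p] R[OF e]])
      ultimately show "conv_form (volterra (monom01 i)) (monom01 j) = conv_form (monom01 i) (volterra (monom01 j) :: real \<Rightarrow> 'a)"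
        by (simp add: conv_form_monom01 beta01_Suc)
    qed
  qed
  show ?thesis
    unfolding volterra_form_def using L sym V by blast
qed

section \<open>Operators commuting with the Volterra operator\<close>

definition commutes_volterra :: "real \<Rightarrow> ((real \<Rightarrow> 'k::{real_normed_field,banach,second_countable_topology}) \<Rightarrow> real \<Rightarrow> 'k) \<Rightarrow> bool" where
  "commutes_volterra p T \<longleftrightarrow> (\<forall>f\<in>Lp01 p. weak_eq p (T (volterra f)) (volterra (T f)))"

section \<open>Action of the commutant on monomials\<close>

lemma commutes_volterraD:
  "commutes_volterra p T \<Longrightarrow> f \<in> Lp01 p \<Longrightarrow> weak_eq p (T (volterra f)) (volterra (T f))"
  by (simp add: commutes_volterra_def)

lemma commutes_volterra_funpow:
  assumes "commutes_volterra p T" "weak_op p T"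
  shows "commutes_volterra p (T ^^ n)"
  unfolding commutes_volterra_def
proof
  fix f :: "real \<Rightarrow> 'a" assume f: "f \<in> Lp01 p"
  show "weak_eq p ((T ^^ n) (volterra f)) (volterra ((T ^^ n) f))"
  proof (induction n)
    case (Suc n)
    have "(T ^^ n) f \<in> Lp01 p"
      by (rule weak_op_Lp01[OF weak_op_funpow[OF assms(2)] f])
    then show ?case
      using weak_eq_trans[OF weak_eq_op[OF assms(2) Suc] commutes_volterraD[OF assms(1)]] by simp
  qed (simp add: weak_eq_refl)
qed

lemma volterra_funpow_monom01:
  assumes "1 \<le> p"
  shows "weak_eq p ((volterra ^^ i) (monom01 j)) (monom01 (i + j))"
proof (induction i)
  case (Suc i)
  show ?case
    using weak_eq_trans[OF weak_eq_op[OF weak_op_volterra[OF assms] Suc] weak_eq_volterra_monom01[OF assms]]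
    by simp
qed (simp add: weak_eq_refl)

text \<open>Since \<open>monom01 i\<close> is the \<open>i\<close>-th Volterra iterate of the
  constant 1, an operator commuting with \<open>volterra\<close> is determined on monomials by its
  value at 1.\<close>

lemma op_monom01:
  assumes "weak_op p T" "commutes_volterra p T" "1 \<le> p"
  shows "weak_eq p (T (monom01 i)) ((volterra ^^ i) (T (monom01 0)))"
proof (induction i)
  case (Suc i)
  have e: "monom01 i \<in> Lp01 p" using assms(3) by (intro monom01_Lp01) simp
  have "weak_eq p (T (monom01 (Suc i))) (T (volterra (monom01 i)))"
    using weak_eqD[OF weak_eq_op[OF assms(1) weak_eq_volterra_monom01[OF assms(3)]]]
    by (rule weak_eqI[OF sym])
  from weak_eq_trans[OF this commutes_volterraD[OF assms(2) e]]
  have "weak_eq p (T (monom01 (Suc i))) (volterra (T (monom01 i)))" .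
  from weak_eq_trans[OF this weak_eq_op[OF weak_op_volterra[OF assms(3)] Suc]]
  show ?case by simp
qed (simp add: weak_eq_refl)

lemma volterra_funpow_Lp01: "f \<in> Lp01 p \<Longrightarrow> 1 \<le> p \<Longrightarrow> (volterra ^^ i) f \<in> Lp01 p"
  by (rule weak_op_Lp01[OF weak_op_funpow[OF weak_op_volterra]])

lemma volterra_form_funpow:
  assumes "volterra_form p \<beta>" "f \<in> Lp01 p" "g \<in> Lp01 p" "1 \<le> p"
  shows "\<beta> ((volterra ^^ i) f) g = \<beta> f ((volterra ^^ i) g)"
  using assms(3)
proof (induction i arbitrary: g)
  case (Suc i)
  have "\<beta> ((volterra ^^ Suc i) f) g = \<beta> ((volterra ^^ i) f) (volterra g)"
    using volterra_form_volterra[OF assms(1) volterra_funpow_Lp01[OF assms(2,4)] Suc.prems] by simp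
  also have "\<dots> = \<beta> f ((volterra ^^ Suc i) g)"
    using Suc.IH[OF volterra_Lp01[OF Suc.prems assms(4)]] by (simp add: funpow_swap1)
  finally show ?case .
qed simp

text \<open>All powers of \<open>volterra\<close> move to \<open>g\<close>, so that \<open>T\<close>
  enters only through \<open>T (monom01 0)\<close>.\<close>

lemma volterra_form_op_monom01:
  assumes "volterra_form p \<beta>" "weak_op p T" "commutes_volterra p T" "g \<in> Lp01 p" "1 \<le> p"
  shows "\<beta> (T (monom01 i)) g = \<beta> ((volterra ^^ i) g) (T (monom01 0))"
proof -
  have e: "T (monom01 0) \<in> Lp01 p"
    using assms(5) by (intro weak_op_Lp01[OF assms(2)] monom01_Lp01) simp
  have "\<beta> (T (monom01 i)) g = \<beta> ((volterra ^^ i) (T (monom01 0))) g"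
    by (rule volterra_form_cong[OF assms(1) op_monom01[OF assms(2,3,5)] assms(4)])
  also have "\<dots> = \<beta> (T (monom01 0)) ((volterra ^^ i) g)"
    by (rule volterra_form_funpow[OF assms(1) e assms(4,5)])
  also have "\<dots> = \<beta> ((volterra ^^ i) g) (T (monom01 0))"
    by (rule volterra_form_sym[OF assms(1) e volterra_funpow_Lp01[OF assms(4,5)]])
  finally show ?thesis .
qed

section \<open>Symmetry and commutativity of the commutant with respect to a form\<close>

lemma volterra_form_functional_right:
  assumes "volterra_form p \<beta>" "f \<in> Lp01 p" "0 \<le> p"
  shows "bounded_functional_Lp p (\<beta> f)"
proof -
  have "\<beta> f g = \<beta> g f" if "g \<in> Lp01 p" for g
    by (rule volterra_form_sym[OF assms(1,2) that])
  then show ?thesis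
    using volterra_form_functional[OF assms(1,2)] assms(3)
    unfolding bounded_functional_Lp_def by (simp add: Lp01_lincomb)
qed

text \<open>On monomials the left side becomes
  \<open>\<beta> (monom01 (i + j)) (T (monom01 0))\<close>, which is symmetric in \<open>i\<close>
  and \<open>j\<close>; density does the rest.\<close>

lemma volterra_form_op:
  assumes \<beta>: "volterra_form p \<beta>" and T: "weak_op p T" "commutes_volterra p T" and p: "1 \<le> p"
    and f: "f \<in> Lp01 p" and g: "g \<in> Lp01 p"
  shows "\<beta> (T f) g = \<beta> f (T g)"
proof -
  have p0: "0 < p" "0 \<le> p" using p by auto
  note e = monom01_Lp01[OF p0(2)]
  note TL = weak_op_Lp01[OF T(1)]
  note L = volterra_form_functional[OF \<beta>] and R = volterra_form_functional_right[OF \<beta> _ p0(2)]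
  have mono: "\<beta> (T (monom01 i)) (monom01 j) = \<beta> (monom01 (i + j)) (T (monom01 0))" for i j
    using volterra_form_op_monom01[OF \<beta> T e p]
      volterra_form_cong[OF \<beta> volterra_funpow_monom01[OF p] TL[OF e]] by simp
  show ?thesis
  proof (rule bounded_functional_eqI[OF weak_op_functional[OF T(1) L[OF g]] L[OF TL[OF g]] p0(1) _ f])
    fix i
    show "\<beta> (T (monom01 i)) g = \<beta> (monom01 i) (T g)"
    proof (rule bounded_functional_eqI[OF R[OF TL[OF e]] weak_op_functional[OF T(1) R[OF e]] p0(1) _ g])
      fix j
      have "\<beta> (monom01 i) (T (monom01 j)) = \<beta> (T (monom01 j)) (monom01 i)"
        by (rule volterra_form_sym[OF \<beta> e TL[OF e]])
      then show "\<beta> (T (monom01 i)) (monom01 j) = \<beta> (monom01 i) (T (monom01 j))"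
        by (simp add: mono add.commute)
    qed
  qed
qed

text \<open>By symmetry of \<open>T\<close> and \<open>U\<close> the claim on monomials says that
  \<open>\<beta> (U (monom01 i)) (T (monom01 j))\<close> is symmetric in \<open>i\<close> and
  \<open>j\<close>, and it depends only on \<open>i + j\<close>. Commutativity as seen by the form
  is what the Leibniz rule uses.\<close>

lemma volterra_form_op_commute:
  assumes \<beta>: "volterra_form p \<beta>" and T: "weak_op p T" "commutes_volterra p T"
    and U: "weak_op p U" "commutes_volterra p U" and p: "1 \<le> p"
    and f: "f \<in> Lp01 p" and g: "g \<in> Lp01 p"
  shows "\<beta> (T (U f)) g = \<beta> (U (T f)) g"
proof -
  have p0: "0 < p" "0 \<le> p" using p by auto
  note e = monom01_Lp01[OF p0(2)]
  note TL = weak_op_Lp01[OF T(1)] and UL = weak_op_Lp01[OF U(1)]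
  note L = volterra_form_functional[OF \<beta>] and R = volterra_form_functional_right[OF \<beta> _ p0(2)]
  have mono: "\<beta> (U (monom01 i)) (T (monom01 j)) = \<beta> ((volterra ^^ (i + j)) (T (monom01 0))) (U (monom01 0))" for i j
  proof -
    have "weak_eq p ((volterra ^^ i) (T (monom01 j))) ((volterra ^^ (i + j)) (T (monom01 0)))"
      using weak_eq_op[OF weak_op_funpow[OF weak_op_volterra[OF p]] op_monom01[OF T p]]
      by (simp add: funpow_add)
    then show ?thesis
      using volterra_form_op_monom01[OF \<beta> U TL[OF e] p] volterra_form_cong[OF \<beta> _ UL[OF e]] by metis
  qed
  show ?thesis
  proof (rule bounded_functional_eqI[OF weak_op_functional[OF U(1) weak_op_functional[OF T(1) L[OF g]]]
        weak_op_functional[OF T(1) weak_op_functional[OF U(1) L[OF g]]] p0(1) _ f])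
    fix i
    show "\<beta> (T (U (monom01 i))) g = \<beta> (U (T (monom01 i))) g"
    proof (rule bounded_functional_eqI[OF R[OF TL[OF UL[OF e]]] R[OF UL[OF TL[OF e]]] p0(1) _ g])
      fix j
      have "\<beta> (T (U (monom01 i))) (monom01 j) = \<beta> (U (monom01 i)) (T (monom01 j))"
        by (rule volterra_form_op[OF \<beta> T p UL[OF e] e])
      moreover have "\<beta> (U (T (monom01 i))) (monom01 j) = \<beta> (T (monom01 i)) (U (monom01 j))"
        by (rule volterra_form_op[OF \<beta> U p TL[OF e] e])
      moreover have "\<beta> (T (monom01 i)) (U (monom01 j)) = \<beta> (U (monom01 j)) (T (monom01 i))"
        by (rule volterra_form_sym[OF \<beta> TL[OF e] UL[OF e]])
      ultimately show "\<beta> (T (U (monom01 i))) (monom01 j) = \<beta> (U (T (monom01 i))) (monom01 j)"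
        by (simp add: mono add.commute)
    qed
  qed
qed

section \<open>Multiplication by the variable\<close>

lemma mult_id_monom01:
  "(\<lambda>t. of_real t * monom01 i t) = (\<lambda>t. of_nat (Suc i) * (monom01 (Suc i) t :: 'k::{real_normed_field,banach,second_countable_topology}))"
proof
  fix t :: real
  have "t * (t ^ i / fact i) = real (Suc i) * (t ^ Suc i / fact (Suc i))"
    by (simp add: divide_simps del: of_nat_Suc)
  then have "of_real (t * (t ^ i / fact i)) = (of_real (real (Suc i) * (t ^ Suc i / fact (Suc i))) :: 'k)"
    by simp
  then show "of_real t * monom01 i t = (of_nat (Suc i) * monom01 (Suc i) t :: 'k)"
    unfolding monom01_def of_real_mult of_real_of_nat_eq .
qed

text \<open>This is \<open>[D, V] = V\<^sup>2\<close> for multiplication \<open>D\<close> by the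
  variable. On \<open>monom01 i\<close> all three terms are multiples of
  \<open>monom01 (i + 2)\<close>, with coefficients i+2 = (i+1) + 1.\<close>

lemma mult_id_volterra:
  fixes f :: "real \<Rightarrow> 'k::{real_normed_field,banach,second_countable_topology}"
  assumes p: "1 \<le> p" and f: "f \<in> Lp01 p" and \<phi>: "bounded_functional_Lp p \<phi>"
  shows "\<phi> (\<lambda>t. of_real t * volterra f t) = \<phi> (volterra (\<lambda>s. of_real s * f s)) + \<phi> (volterra (volterra f))"
proof -
  have p0: "0 < p" "0 \<le> p" using p by auto
  note D = weak_op_mult_id[OF p] and V = weak_op_volterra[OF p]
  note e = monom01_Lp01[OF p0(2)]
  show ?thesis
  proof (rule bounded_functional_eqI[OF weak_op_functional[OF V weak_op_functional[OF D \<phi>]]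
      bounded_functional_Lp_add[OF weak_op_functional[OF D weak_op_functional[OF V \<phi>]]
        weak_op_functional[OF V weak_op_functional[OF V \<phi>]]] p0(1) _ f])
    fix i
    have "\<phi> (\<lambda>t. of_real t * volterra (monom01 i) t) = \<phi> (\<lambda>t. of_real t * monom01 (Suc i) t)"
      by (rule weak_eqD[OF weak_eq_op[OF D weak_eq_volterra_monom01[OF p]] \<phi>])
    also have "\<dots> = of_nat (Suc (Suc i)) * \<phi> (monom01 (Suc (Suc i)))"
      unfolding mult_id_monom01 by (rule bounded_functional_cmult[OF \<phi> e])
    finally have 1: "\<phi> (\<lambda>t. of_real t * volterra (monom01 i) t) = of_nat (Suc (Suc i)) * \<phi> (monom01 (Suc (Suc i)))" .
    have "\<phi> (volterra (\<lambda>s. of_real s * monom01 i s)) = of_nat (Suc i) * \<phi> (volterra (monom01 (Suc i)))"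
      unfolding mult_id_monom01 by (rule bounded_functional_cmult[OF weak_op_functional[OF V \<phi>] e])
    also have "\<phi> (volterra (monom01 (Suc i))) = \<phi> (monom01 (Suc (Suc i)))"
      by (rule weak_eqD[OF weak_eq_volterra_monom01[OF p] \<phi>])
    finally have 2: "\<phi> (volterra (\<lambda>s. of_real s * monom01 i s)) = of_nat (Suc i) * \<phi> (monom01 (Suc (Suc i)))" .
    have 3: "\<phi> (volterra (volterra (monom01 i))) = \<phi> (monom01 (Suc (Suc i)))"
      using weak_eqD[OF volterra_funpow_monom01[OF p, of 2 i] \<phi>] by (simp add: numeral_2_eq_2)
    show "\<phi> (\<lambda>t. of_real t * volterra (monom01 i) t) =
        \<phi> (volterra (\<lambda>s. of_real s * monom01 i s)) + \<phi> (volterra (volterra (monom01 i)))"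
      unfolding 1 2 3 by (simp add: algebra_simps)
  qed
qed

section \<open>The derivation sending \<open>T\<close> to \<open>[D, T]\<close>, and its Leibniz
  rule\<close>

definition mult_commutator :: "((real \<Rightarrow> 'k::real_normed_field) \<Rightarrow> real \<Rightarrow> 'k) \<Rightarrow> (real \<Rightarrow> 'k) \<Rightarrow> real \<Rightarrow> 'k" where
  "mult_commutator T f = (\<lambda>t. of_real t * T f t - T (\<lambda>s. of_real s * f s) t)"

lemma weak_op_mult_commutator:
  assumes "weak_op p T" "1 \<le> p"
  shows "weak_op p (mult_commutator T)"
  unfolding mult_commutator_def[abs_def]
  using assms(2)
  by (intro weak_op_diff[OF weak_op_comp[OF weak_op_mult_id assms(1)] weak_op_comp[OF assms(1) weak_op_mult_id]]) auto

text \<open>This is the Jacobi identity, because \<open>[D, V] = V\<^sup>2\<close> for the multiplication \<open>D\<close> by the variable.\<close>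
lemma commutes_volterra_mult_commutator:
  assumes T: "weak_op p T" "commutes_volterra p T" and p: "1 \<le> p"
  shows "commutes_volterra p (mult_commutator T)"
  unfolding commutes_volterra_def
proof (intro ballI weak_eqI)
  fix f :: "real \<Rightarrow> 'a" and \<phi> :: "(real \<Rightarrow> 'a) \<Rightarrow> 'a"
  assume f: "f \<in> Lp01 p" and \<phi>: "bounded_functional_Lp p \<phi>"
  let ?D = "\<lambda>(f::real \<Rightarrow> 'a) t. of_real t * f t" and ?V = "volterra :: (real \<Rightarrow> 'a) \<Rightarrow> real \<Rightarrow> 'a"
  note D = weak_op_mult_id[OF p] and V = weak_op_volterra[OF p]
  note DL = weak_op_Lp01[OF D] and VL = weak_op_Lp01[OF V] and TL = weak_op_Lp01[OF T(1)]
  have "\<phi> (?D (T (?V f))) = \<phi> (?D (?V (T f)))"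
    by (rule weak_eqD[OF weak_eq_op[OF D commutes_volterraD[OF T(2) f]] \<phi>])
  also have "\<dots> = \<phi> (?V (?D (T f))) + \<phi> (?V (?V (T f)))"
    by (rule mult_id_volterra[OF p TL[OF f] \<phi>])
  finally have 1: "\<phi> (?D (T (?V f))) = \<phi> (?V (?D (T f))) + \<phi> (?V (?V (T f)))" .
  \<comment> \<open>The same commutation relation, tested with the functional \<open>\<phi>\<close>
    composed with \<open>T\<close>.\<close>
  have "\<phi> (T (?D (?V f))) = \<phi> (T (?V (?D f))) + \<phi> (T (?V (?V f)))"
    by (rule mult_id_volterra[OF p f weak_op_functional[OF T(1) \<phi>]])
  also have "\<phi> (T (?V (?D f))) = \<phi> (?V (T (?D f)))"
    by (rule weak_eqD[OF commutes_volterraD[OF T(2) DL[OF f]] \<phi>])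
  also have "\<phi> (T (?V (?V f))) = \<phi> (?V (T (?V f)))"
    by (rule weak_eqD[OF commutes_volterraD[OF T(2) VL[OF f]] \<phi>])
  also have "\<phi> (?V (T (?V f))) = \<phi> (?V (?V (T f)))"
    by (rule weak_eqD[OF weak_eq_op[OF V commutes_volterraD[OF T(2) f]] \<phi>])
  finally have 2: "\<phi> (T (?D (?V f))) = \<phi> (?V (T (?D f))) + \<phi> (?V (?V (T f)))" .
  have "\<phi> (mult_commutator T (?V f)) = \<phi> (?D (T (?V f))) - \<phi> (T (?D (?V f)))"
    unfolding mult_commutator_def
    by (rule bounded_functional_diff[OF \<phi> DL[OF TL[OF VL[OF f]]] TL[OF DL[OF VL[OF f]]]])
  moreover have "\<phi> (?V (mult_commutator T f)) = \<phi> (?V (?D (T f))) - \<phi> (?V (T (?D f)))"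
    unfolding mult_commutator_def
    by (rule bounded_functional_diff[OF weak_op_functional[OF V \<phi>] DL[OF TL[OF f]] TL[OF DL[OF f]]])
  \<comment> \<open>The terms \<open>\<phi> (?V (?V (T f)))\<close> of \<open>1\<close> and
    \<open>2\<close> cancel in the difference.\<close>
  ultimately show "\<phi> (mult_commutator T (?V f)) = \<phi> (?V (mult_commutator T f))"
    by (simp add: 1 2)
qed

text \<open>Leibniz' rule \<open>D T\<^sup>n = T\<^sup>n D + n T\<^sup>n\<^sup>-\<^sup>1 [D, T]\<close>, tested against \<open>T g\<close>.\<close>
lemma volterra_form_mult_id_funpow:
  assumes \<beta>: "volterra_form p \<beta>" and T: "weak_op p T" "commutes_volterra p T" and p: "1 \<le> p"
    and f: "f \<in> Lp01 p" and g: "g \<in> Lp01 p"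
  shows "\<beta> (\<lambda>t. of_real t * (T ^^ n) f t) (T g) =
    \<beta> (\<lambda>t. of_real t * f t) ((T ^^ Suc n) g) + of_nat n * \<beta> (mult_commutator T f) ((T ^^ n) g)"
  using g
\<comment> \<open>The induction hypothesis is used at \<open>T g\<close>. Testing against
  \<open>T g\<close> also turns the power n-1 of the Leibniz rule into n, so that
  \<open>n = 0\<close> is no exception.\<close>
proof (induction n arbitrary: g)
  case (Suc n)
  let ?D = "\<lambda>(f::real \<Rightarrow> 'a) t. of_real t * f t" and ?C = "mult_commutator T"
  note D = weak_op_mult_id[OF p]
  note C = weak_op_mult_commutator[OF T(1) p] commutes_volterra_mult_commutator[OF T p]
  note Tn = weak_op_funpow[OF T(1), of n] commutes_volterra_funpow[OF T(2,1), of n]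
  note DL = weak_op_Lp01[OF D] and TL = weak_op_Lp01[OF T(1)] and CL = weak_op_Lp01[OF C(1)]
    and TnL = weak_op_Lp01[OF Tn(1)]
  note g = Suc.prems
  have "?D ((T ^^ Suc n) f) = (\<lambda>t. ?C ((T ^^ n) f) t + T (?D ((T ^^ n) f)) t)"
    by (simp add: mult_commutator_def)
  then have "\<beta> (?D ((T ^^ Suc n) f)) (T g) = \<beta> (?C ((T ^^ n) f)) (T g) + \<beta> (T (?D ((T ^^ n) f))) (T g)"
    using bounded_functional_add[OF volterra_form_functional[OF \<beta> TL[OF g]] CL[OF TnL[OF f]] TL[OF DL[OF TnL[OF f]]]]
    by simp
  \<comment> \<open>The commutator \<open>?C\<close> commutes with \<open>volterra\<close> as well,
    so it can be moved past the power of \<open>T\<close> inside the form.\<close>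
  also have "\<beta> (?C ((T ^^ n) f)) (T g) = \<beta> ((T ^^ n) (?C f)) (T g)"
    by (rule volterra_form_op_commute[OF \<beta> C Tn p f TL[OF g]])
  also have "\<dots> = \<beta> (?C f) ((T ^^ n) (T g))"
    by (rule volterra_form_op[OF \<beta> Tn p CL[OF f] TL[OF g]])
  also have "\<beta> (T (?D ((T ^^ n) f))) (T g) = \<beta> (?D ((T ^^ n) f)) (T (T g))"
    by (rule volterra_form_op[OF \<beta> T p DL[OF TnL[OF f]] TL[OF g]])
  also have "\<dots> = \<beta> (?D f) ((T ^^ Suc n) (T g)) + of_nat n * \<beta> (?C f) ((T ^^ n) (T g))"
    by (rule Suc.IH[OF TL[OF g]])
  finally show ?case
    by (simp add: funpow_swap1 algebra_simps)
qed simp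

section \<open>Projectively dense sequences\<close>

text \<open>Weak density is kept only for pairs of functionals, that is, for images in the plane.
  The scalar \<open>z\<close> stands outside the functionals, so only the sequence itself
  enters.\<close>

definition projectively_dense :: "real \<Rightarrow> (nat \<Rightarrow> real \<Rightarrow> 'k::{real_normed_field,banach,second_countable_topology}) \<Rightarrow> bool" where
  "projectively_dense p u \<longleftrightarrow> (\<forall>g\<in>Lp01 p. \<forall>\<phi> \<psi>. bounded_functional_Lp p \<phi> \<longrightarrow> bounded_functional_Lp p \<psi> \<longrightarrow>
     (\<forall>e>0. \<exists>z n. norm (z * \<phi> (u n) - \<phi> g) < e \<and> norm (z * \<psi> (u n) - \<psi> g) < e))"

lemma projectively_denseD:
  assumes "projectively_dense p u" "g \<in> Lp01 p" "bounded_functional_Lp p \<phi>" "bounded_functional_Lp p \<psi>" "0 < e"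
  obtains z n where "norm (z * \<phi> (u n) - \<phi> g) < e" "norm (z * \<psi> (u n) - \<psi> g) < e"
proof -
  have "\<exists>z n. norm (z * \<phi> (u n) - \<phi> g) < e \<and> norm (z * \<psi> (u n) - \<psi> g) < e"
    by (rule assms(1)[unfolded projectively_dense_def, rule_format, OF assms(2-5)])
  then show thesis using that by blast
qed

text \<open>Otherwise every functional would be a multiple of \<open>\<phi>\<close> and the matrix
  of \<open>conv_form\<close> on monomials would have rank one. Its leading 2 by 2 minor 1/(2! 4!) -
  1/(3!)^2 is nonzero.\<close>

lemma functional_not_proportional:
  fixes \<phi> :: "(real \<Rightarrow> 'k::{real_normed_field,banach,second_countable_topology}) \<Rightarrow> 'k"
  assumes p: "1 \<le> p"
  shows "\<exists>\<psi>. bounded_functional_Lp p \<psi> \<and> (\<exists>h\<in>Lp01 p. \<psi> h \<noteq> r \<psi> * \<phi> h)"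
proof (rule ccontr)
  assume "\<not> ?thesis"
  then have eq: "\<psi> h = r \<psi> * \<phi> h" if "bounded_functional_Lp p \<psi>" "h \<in> Lp01 p" for \<psi> h
    using that by blast
  define c where "c j = r (\<lambda>f. conv_form f (monom01 j))" for j
  have e: "monom01 i \<in> Lp01 p" for i using p by (intro monom01_Lp01) simp
  have v: "of_real (1 / fact (Suc (Suc (i + j)))) = c j * \<phi> (monom01 i)" for i j
    using eq[OF conv_form_functional(1)[OF p e] e, of i j]
    unfolding c_def conv_form_monom01 beta01_value by simp
  \<comment> \<open>Both products equal
    \<open>c 0 * c 1 * \<phi> (monom01 0) * \<phi> (monom01 1)\<close>.\<close>
  have "(of_real (1 / fact 2 * (1 / fact 4)) :: 'k) = of_real (1 / fact 3 * (1 / fact 3))"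
    unfolding of_real_mult using v[of 0 0] v[of 1 1] v[of 1 0] v[of 0 1]
    by (simp add: numeral_eq_Suc del: of_real_divide fact_Suc)
  then have "(1 / fact 2 * (1 / fact 4) :: real) = 1 / fact 3 * (1 / fact 3)"
    by (simp only: of_real_eq_iff)
  then show False by (simp add: fact_numeral)
qed

text \<open>Only multiples of \<open>u N\<close> can approximate a \<open>g\<close> with
  \<open>\<phi> g \<noteq> 0\<close>. A second functional \<open>\<psi>\<close> detects such a
  \<open>g\<close> away from that single line.\<close>

lemma projectively_dense_vanish:
  assumes p: "1 \<le> p" and u: "projectively_dense p u" and \<phi>: "bounded_functional_Lp p \<phi>"
    and van: "\<And>n. n \<noteq> N \<Longrightarrow> \<phi> (u n) = 0" and f: "f \<in> Lp01 p"
  shows "\<phi> f = 0"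
proof (rule ccontr)
  assume f0: "\<phi> f \<noteq> 0"
  obtain \<psi> h where \<psi>: "bounded_functional_Lp p \<psi>" and h: "h \<in> Lp01 p"
    and ne: "\<psi> h \<noteq> \<psi> (u N) / \<phi> (u N) * \<phi> h"
    using functional_not_proportional[OF p, where r = "\<lambda>\<psi>. \<psi> (u N) / \<phi> (u N)" and \<phi> = \<phi>] by blast
  \<comment> \<open>If \<open>\<phi> (u N) = 0\<close>, division by zero makes \<open>r = 0\<close>.
    This is harmless: the relation between \<open>\<psi>\<close> and \<open>\<phi>\<close> is drawn
    only once \<open>\<phi> (u n) \<noteq> 0\<close> and \<open>n = N\<close> are known.\<close>
  define r where "r = \<psi> (u N) / \<phi> (u N)"
  \<comment> \<open>Two proper subspaces do not cover the space: one of \<open>f\<close>,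
    \<open>h\<close> and \<open>f + h\<close> avoids both.\<close>
  have "\<exists>g\<in>Lp01 p. \<phi> g \<noteq> 0 \<and> \<psi> g \<noteq> r * \<phi> g"
  proof (cases "\<phi> h \<noteq> 0 \<or> \<psi> f \<noteq> r * \<phi> f")
    case True
    then show ?thesis using h f f0 ne by (auto simp: r_def)
  next
    case False
    then have "\<phi> (\<lambda>t. f t + h t) \<noteq> 0 \<and> \<psi> (\<lambda>t. f t + h t) \<noteq> r * \<phi> (\<lambda>t. f t + h t)"
      using f0 ne by (simp add: bounded_functional_add[OF \<phi> f h] bounded_functional_add[OF \<psi> f h] r_def)
    then show ?thesis using p by (intro bexI[OF _ Lp01_add[OF f h]]) auto
  qed
  then obtain g where g: "g \<in> Lp01 p" "\<phi> g \<noteq> 0" "\<psi> g \<noteq> r * \<phi> g" by blast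
  \<comment> \<open>The first bound forces \<open>\<phi> (u n) \<noteq> 0\<close>; the second makes
    an error of \<open>e\<close> in both functionals too small to reach \<open>g\<close> from the
    line of slope \<open>r\<close>.\<close>
  define e where "e = min (norm (\<phi> g)) (norm (\<psi> g - r * \<phi> g) / (1 + norm r))"
  have r1: "0 < 1 + norm r" by (simp add: add_pos_nonneg)
  have e: "0 < e" using g r1 by (simp add: e_def)
  obtain z n where zn: "norm (z * \<phi> (u n) - \<phi> g) < e" "norm (z * \<psi> (u n) - \<psi> g) < e"
    using projectively_denseD[OF u g(1) \<phi> \<psi> e] by blast
  have un: "\<phi> (u n) \<noteq> 0" using zn(1) by (auto simp: e_def)
  then have "n = N" using van by blast
  with un have \<psi>u: "\<psi> (u n) = r * \<phi> (u n)" by (simp add: r_def)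
  have "\<psi> g - r * \<phi> g = - (z * \<psi> (u n) - \<psi> g) + r * (z * \<phi> (u n) - \<phi> g)"
    by (simp add: \<psi>u algebra_simps)
  then have "norm (\<psi> g - r * \<phi> g) \<le> norm (z * \<psi> (u n) - \<psi> g) + norm r * norm (z * \<phi> (u n) - \<phi> g)"
    by (metis norm_minus_cancel norm_mult norm_triangle_ineq)
  also have "\<dots> < e + norm r * e"
    using zn by (intro add_less_le_mono mult_left_mono) auto
  also have "\<dots> = e * (1 + norm r)" by (simp add: algebra_simps)
  also have "\<dots> \<le> norm (\<psi> g - r * \<phi> g)"
    using r1 by (simp add: e_def flip: pos_le_divide_eq)
  finally show False by simp
qed

text \<open>Otherwise some \<open>g\<close> has \<open>\<psi> g = 1\<close> and \<open>\<phi> g = 1/2\<close>; it is far from the lines through the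
  \<open>u n\<close>, on which the quotient of the two functionals is an integer.\<close>
lemma projectively_dense_nat_multiple:
  assumes p: "1 \<le> p" and u: "projectively_dense p u" "\<And>n. u n \<in> Lp01 p"
    and \<phi>: "bounded_functional_Lp p \<phi>" and \<psi>: "bounded_functional_Lp p \<psi>"
    and rel: "\<And>n. \<phi> (u n) = of_nat n * \<psi> (u n)" and f: "f \<in> Lp01 p"
  shows "\<phi> f = 0"
proof -
  have \<psi>0: "\<psi> v = 0" if v: "v \<in> Lp01 p" for v
  proof (rule ccontr)
    assume v0: "\<psi> v \<noteq> 0"
    define c where "c = \<phi> v / \<psi> v"
    show False
    proof (cases "\<forall>h\<in>Lp01 p. \<phi> h = c * \<psi> h")
      \<comment> \<open>If \<open>\<phi>\<close> is \<open>c\<close> times \<open>\<psi>\<close>,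
        then \<open>of_nat n = c\<close> wherever \<open>\<psi> (u n)\<close> is nonzero, which
        allows at most one index.\<close>
      case True
      have "\<exists>N. \<forall>n. n \<noteq> N \<longrightarrow> of_nat n \<noteq> c"
        by (metis of_nat_eq_iff)
      then obtain N where N: "\<And>n. n \<noteq> N \<Longrightarrow> of_nat n \<noteq> c" by blast
      have "\<psi> (u n) = 0" if "n \<noteq> N" for n
        using rel[of n] bspec[OF True u(2), of n] N[OF that] by simp
      then show False
        using projectively_dense_vanish[OF p u(1) \<psi> _ v, of N] v0 by blast
    next
      case False
      then obtain h where h: "h \<in> Lp01 p" "\<phi> h \<noteq> c * \<psi> h" by blast
      define d where "d = \<phi> h - c * \<psi> h"
      have d0: "d \<noteq> 0" using h(2) by (simp add: d_def)
      \<comment> \<open>The vector \<open>k\<close> lies in the kernel of \<open>\<psi>\<close> but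
        not of \<open>\<phi>\<close>; adding a multiple of it adjusts \<open>\<phi>\<close> at fixed
        \<open>\<psi>\<close>.\<close>
      define k where "k t = (- (\<psi> h / \<psi> v)) * v t + h t" for t
      have k: "k \<in> Lp01 p"
        unfolding k_def[abs_def] using p by (intro Lp01_lincomb v h(1)) auto
      have "\<psi> k = 0" "\<phi> k = d"
        unfolding k_def[abs_def] bounded_functional_lincomb[OF \<psi> v h(1)] bounded_functional_lincomb[OF \<phi> v h(1)]
        using v0 by (auto simp: d_def c_def)
      \<comment> \<open>The multiple of \<open>v\<close> contributes 1 to \<open>\<psi>\<close> and
        \<open>c\<close> to \<open>\<phi>\<close>; the multiple of \<open>k\<close> corrects
        \<open>\<phi>\<close> by \<open>1/2 - c\<close>.\<close>
      define g where "g t = ((1/2 - c) / d) * k t + (1 / \<psi> v) * v t" for t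
      have v': "(\<lambda>t. (1 / \<psi> v) * v t) \<in> Lp01 p" using p v by (intro Lp01_cmult) auto
      have g: "g \<in> Lp01 p"
        unfolding g_def[abs_def] using p by (intro Lp01_lincomb k v') auto
      have g1: "\<psi> g = 1"
        unfolding g_def[abs_def] bounded_functional_lincomb[OF \<psi> k v'] bounded_functional_cmult[OF \<psi> v]
        using v0 \<open>\<psi> k = 0\<close> by simp
      have g2: "\<phi> g = 1/2"
        unfolding g_def[abs_def] bounded_functional_lincomb[OF \<phi> k v'] bounded_functional_cmult[OF \<phi> v]
        using d0 \<open>\<phi> k = d\<close> by (simp add: c_def)
      obtain z n where zn: "norm (z * \<phi> (u n) - 1/2) < 1/4" "norm (z * \<psi> (u n) - 1) < 1/4"
        using projectively_denseD[OF u(1) g \<phi> \<psi>, of "1/4"] g1 g2 by auto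
      define y where "y = z * \<psi> (u n)"
      have y: "norm (of_nat n * y - 1/2) < 1/4" "norm (y - 1) < 1/4"
        using zn by (simp_all add: y_def rel mult.left_commute)
      have half: "norm (1/2 :: 'a) = 1/2" by (simp add: norm_divide)
      \<comment> \<open>The number \<open>y\<close> is close to 1 and its \<open>n\<close>-fold is
        close to 1/2, which excludes \<open>n = 0\<close> as well as every
        \<open>n \<ge> 1\<close>.\<close>
      have "3/4 < norm y"
        using y(2) norm_triangle_ineq2[of 1 "1 - y"] by (simp add: norm_minus_commute)
      moreover have "real n * norm y < 3/4"
        using norm_triangle_ineq2[of "of_nat n * y" "1/2"] y(1) half by (simp add: norm_mult)
      moreover have "n \<noteq> 0" using y(1) half by (cases n) auto
      then have "norm y \<le> real n * norm y"
        using mult_right_mono[of 1 "real n" "norm y"] by simp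
      ultimately show False by linarith
    qed
  qed
  then have "\<phi> (u n) = 0" for n using rel u(2) by simp
  then show ?thesis
    by (intro projectively_dense_vanish[OF p u(1) \<phi> _ f]) auto
qed

section \<open>The contradiction on a projective orbit\<close>

lemma orbit_not_projectively_dense:
  assumes T: "weak_op p T" "commutes_volterra p T" and p: "1 \<le> p" and x: "x \<in> Lp01 p"
  shows "\<not> projectively_dense p (\<lambda>n. (T ^^ n) x)"
proof
  assume dense: "projectively_dense p (\<lambda>n. (T ^^ n) x)"
  let ?D = "\<lambda>(f::real \<Rightarrow> 'a) t. of_real t * f t" and ?V = "volterra :: (real \<Rightarrow> 'a) \<Rightarrow> real \<Rightarrow> 'a"
    and ?C = "mult_commutator T" and ?e = "monom01 :: nat \<Rightarrow> real \<Rightarrow> 'a"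
  have p0: "0 \<le> p" using p by simp
  note D = weak_op_mult_id[OF p] and V = weak_op_volterra[OF p]
  note C = weak_op_mult_commutator[OF T(1) p] commutes_volterra_mult_commutator[OF T p]
  note Tn = weak_op_funpow[OF T(1)] commutes_volterra_funpow[OF T(2,1)]
  note DL = weak_op_Lp01[OF D] and VL = weak_op_Lp01[OF V] and TL = weak_op_Lp01[OF T(1)]
    and CL = weak_op_Lp01[OF C(1)] and TnL = weak_op_Lp01[OF Tn(1)]
  note e = monom01_Lp01[OF p0]
  \<comment> \<open>On the orbit the difference of the two sides is \<open>n\<close> times
    \<open>\<beta> w (?C x)\<close>, by the Leibniz rule at \<open>f = g = x\<close>. The form is
    left general because both \<open>conv_form\<close> and its shift are inserted.\<close>
  have key: "\<beta> (?D w) (T x) = \<beta> w (T (?D x))" if \<beta>: "volterra_form p \<beta>" and w: "w \<in> Lp01 p" for \<beta> w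
  proof -
    note L = volterra_form_functional[OF \<beta>]
    have "\<beta> (?D w) (T x) - \<beta> w (T (?D x)) = 0"
    proof (rule projectively_dense_nat_multiple[OF p dense TnL[OF x]
          bounded_functional_Lp_diff[OF weak_op_functional[OF D L[OF TL[OF x]]] L[OF TL[OF DL[OF x]]]] L[OF CL[OF x]] _ w])
      fix n
      have "\<beta> (?D x) ((T ^^ Suc n) x) = \<beta> (T (?D x)) ((T ^^ n) x)"
        using volterra_form_op[OF \<beta> T p DL[OF x] TnL[OF x, of n]] by simp
      also have "\<dots> = \<beta> ((T ^^ n) x) (T (?D x))"
        by (rule volterra_form_sym[OF \<beta> TL[OF DL[OF x]] TnL[OF x]])
      finally show "\<beta> (?D ((T ^^ n) x)) (T x) - \<beta> ((T ^^ n) x) (T (?D x)) = of_nat n * \<beta> ((T ^^ n) x) (?C x)"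
        using volterra_form_mult_id_funpow[OF \<beta> T p x x, of n] volterra_form_sym[OF \<beta> CL[OF x] TnL[OF x, of n]]
        by simp
    qed
    then show ?thesis by simp
  qed
  note \<beta> = volterra_form_conv_form[OF p]
  \<comment> \<open>\<open>key\<close> for \<open>conv_form\<close> at \<open>?V w\<close> and for
    its shift at \<open>w\<close> have the same right side. Comparing their left sides through
    \<open>[D, V] = V\<^sup>2\<close> isolates the term with \<open>?V (?V w)\<close>.\<close>
  have VV: "conv_form (?V (?V w)) (T x) = 0" if w: "w \<in> Lp01 p" for w
  proof -
    have "conv_form (?V (?D w)) (T x) + conv_form (?V (?V w)) (T x) = conv_form (?D (?V w)) (T x)"
      by (rule mult_id_volterra[OF p w volterra_form_functional[OF \<beta> TL[OF x]], symmetric])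
    also have "\<dots> = conv_form (?V w) (T (?D x))"
      by (rule key[OF \<beta> VL[OF w]])
    also have "\<dots> = conv_form (?V (?D w)) (T x)"
      by (rule key[OF volterra_form_shift[OF \<beta> p] w, symmetric])
    finally show ?thesis by simp
  qed
  \<comment> \<open>Since \<open>?e 2\<close> is the second Volterra iterate of 1, moving all but
    one factor \<open>T\<close> onto it produces an instance of \<open>VV\<close>. At least one
    factor is required, so \<open>n = 0\<close> is the exceptional index.\<close>
  have "conv_form ((T ^^ n) x) (?e 2) = 0" if "n \<noteq> 0" for n
  proof -
    obtain m where n: "n = Suc m" using \<open>n \<noteq> 0\<close> not0_implies_Suc by blast
    have "conv_form ((T ^^ n) x) (?e 2) = conv_form ((T ^^ m) (T x)) (?e 2)"
      by (simp add: n funpow_swap1)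
    also have "\<dots> = conv_form (T x) ((T ^^ m) (?e 2))"
      by (rule volterra_form_op[OF \<beta> Tn p TL[OF x] e])
    also have "\<dots> = conv_form ((T ^^ m) (?e 2)) (T x)"
      by (rule volterra_form_sym[OF \<beta> TL[OF x] TnL[OF e]])
    also have "\<dots> = conv_form (?V (?V ((T ^^ m) (?e 0)))) (T x)"
      using volterra_form_cong[OF \<beta> op_monom01[OF Tn p, of m 2] TL[OF x]] by (simp add: numeral_2_eq_2)
    also have "\<dots> = 0" by (rule VV[OF TnL[OF e]])
    finally show ?thesis .
  qed
  \<comment> \<open>The value at \<open>?e 0\<close> is in fact
    \<open>beta01 0 3 = 1 / fact 4\<close>, which is nonzero.\<close>
  then have "conv_form (?e 0) (?e 2) = 0"
    by (intro projectively_dense_vanish[OF p dense conv_form_functional(1)[OF p e] _ e, of 0])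
  then show False
    by (simp add: conv_form_monom01 beta01_value)
qed

text \<open>Identities up to seminorm zero become weak equalities, and weak density is applied to
  families of at most two functionals. The scalar field stays abstract so that the real and the
  complex case are both instances.\<close>

theorem commutes_volterra_not_weakly_supercyclic:
  fixes T :: "(real \<Rightarrow> 'k::{real_normed_field,banach,second_countable_topology}) \<Rightarrow> real \<Rightarrow> 'k"
  assumes p: "1 \<le> p" and T: "bounded_op_Lp p T"
    and comm: "\<And>f. f \<in> Lp01 p \<Longrightarrow> Lp_norm p (\<lambda>x. T (volterra f) x - volterra (T f) x) = 0"
  shows "\<not> weakly_supercyclic_Lp p T"
proof
  assume "weakly_supercyclic_Lp p T"
  then obtain x where x: "x \<in> Lp01 p" and
    dense: "\<forall>g\<in>Lp01 p. \<forall>\<Phi>. finite \<Phi> \<and> (\<forall>\<phi>\<in>\<Phi>. bounded_functional_Lp p \<phi>) \<longrightarrow>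
        (\<forall>e>0. \<exists>z n. \<forall>\<phi>\<in>\<Phi>. norm (\<phi> (\<lambda>t. z * (T ^^ n) x t) - \<phi> g) < e)"
    unfolding weakly_supercyclic_Lp_def by (rule bexE)
  have p0: "0 \<le> p" using p by simp
  have W: "weak_op p T" by (rule bounded_op_imp_weak_op[OF T p0])
  have "weak_eq p (T (volterra f)) (volterra (T f))" if f: "f \<in> Lp01 p" for f
    using bounded_functional_cong[OF _ weak_op_Lp01[OF W volterra_Lp01[OF f p]]
        volterra_Lp01[OF weak_op_Lp01[OF W f] p] p0 comm[OF f]]
    by (rule weak_eqI)
  then have C: "commutes_volterra p T" by (simp add: commutes_volterra_def)
  have "projectively_dense p (\<lambda>n. (T ^^ n) x)"
    unfolding projectively_dense_def
  proof (intro ballI allI impI)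
    fix g :: "real \<Rightarrow> 'k" and \<phi> \<psi> :: "(real \<Rightarrow> 'k) \<Rightarrow> 'k" and e :: real
    assume g: "g \<in> Lp01 p" and \<phi>: "bounded_functional_Lp p \<phi>" and \<psi>: "bounded_functional_Lp p \<psi>" and e: "0 < e"
    have Tn: "(T ^^ n) x \<in> Lp01 p" for n
      by (rule weak_op_Lp01[OF weak_op_funpow[OF W] x])
    have "finite {\<phi>, \<psi>} \<and> (\<forall>\<phi>\<in>{\<phi>, \<psi>}. bounded_functional_Lp p \<phi>)" using \<phi> \<psi> by simp
    from dense[rule_format, OF g this e]
    have "\<exists>z n. \<forall>\<xi>\<in>{\<phi>, \<psi>}. norm (\<xi> (\<lambda>t. z * (T ^^ n) x t) - \<xi> g) < e" .
    then show "\<exists>z n. norm (z * \<phi> ((T ^^ n) x) - \<phi> g) < e \<and> norm (z * \<psi> ((T ^^ n) x) - \<psi> g) < e"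
      by (simp add: bounded_functional_cmult[OF \<phi> Tn] bounded_functional_cmult[OF \<psi> Tn])
  qed
  with orbit_not_projectively_dense[OF W C p x] show False by blast
qed

theorem theorem1p1:
  fixes p :: real
  assumes "1 \<le> p"
  shows "(\<forall>T :: (real \<Rightarrow> real) \<Rightarrow> (real \<Rightarrow> real).
            bounded_op_Lp p T \<and>
            (\<forall>f\<in>Lp01 p. Lp_norm p (\<lambda>x. T (volterra f) x - volterra (T f) x) = 0)
            \<longrightarrow> \<not> weakly_supercyclic_Lp p T) \<and>
         (\<forall>T :: (real \<Rightarrow> complex) \<Rightarrow> (real \<Rightarrow> complex).
            bounded_op_Lp p T \<and>
            (\<forall>f\<in>Lp01 p. Lp_norm p (\<lambda>x. T (volterra f) x - volterra (T f) x) = 0)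
            \<longrightarrow> \<not> weakly_supercyclic_Lp p T)"
  by (intro conjI allI impI; rule commutes_volterra_not_weakly_supercyclic[OF assms]; blast)

end
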